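(* The map $T$ (defined in the context) has the following properties, for all random vectors $\mathbf{X}$, $\mathbf{Z}$ and all random vectors $\mathbf{Y}$ with non-degenerate components (of arbitrary finite dimensions). (i) $T$ is a measure of predictability, i.e.: (A1) $0\le T(\mathbf{Y},\mathbf{X})\le 1$; (A2) $T(\mathbf{Y},\mathbf{X})=0$ if and only if $\mathbf{Y}$ and $\mathbf{X}$ are independent; (A3) $T(\mathbf{Y},\mathbf{X})=1$ if and only if $\mathbf{Y}$ is perfectly dependent on $\mathbf{X}$, i.e., there exists a measurable function $\mathbf{f}:\mathbb{R}^p\to\mathbb{R}^q$ such that $\mathbf{Y}=\mathbf{f}(\mathbf{X})$ almost surely. (ii) (Information gain inequality) $T(\mathbf{Y},\mathbf{X})\le T(\mathbf{Y},(\mathbf{X},\mathbf{Z}))$. (iii) (Characterization of conditional independence) $T(\mathbf{Y},\mathbf{X})=T(\mathbf{Y},(\mathbf{X},\mathbf{Z}))$ if and only if $\mathbf{Y}$ and $\mathbf{Z}$ are conditionally independent given $\mathbf{X}$.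
   Context: All random vectors are defined on a common probability space $(\Omega,\mathcal{A},P)$: $\mathbf{X}=(X_1,\dots,X_p)$, $\mathbf{Y}=(Y_1,\dots,Y_q)$, $\mathbf{Z}=(Z_1,\dots,Z_r)$ with arbitrary $p,q,r\in\{1,2,\dots\}$. The components of $\mathbf{Y}$ are non-degenerate, i.e., no $Y_i$ is almost surely constant. For a non-degenerate real random variable $Y$ and a random vector $\mathbf{X}$ put $$\xi(Y,\mathbf{X}):=\frac{\int_{\mathbb{R}}\mathrm{Var}\big(P(Y\ge y\mid\mathbf{X})\big)\,\mathrm{d}P^{Y}(y)}{\int_{\mathbb{R}}\mathrm{Var}\big(\mathbf{1}_{\{Y\ge y\}}\big)\,\mathrm{d}P^{Y}(y)},$$ where $P^Y$ is the distribution of $Y$. Then $$T(\mathbf{Y},\mathbf{X}):=1-\frac{q-\sum_{i=1}^{q}\xi\big(Y_i,(\mathbf{X},Y_{i-1},\dots,Y_1)\big)}{q-\sum_{i=1}^{q}\xi\big(Y_i,(Y_{i-1},\dots,Y_1)\big)},\qquad \xi(Y_1,\emptyset):=0,$$ where for $i=1$ the vector $(\mathbf{X},Y_{i-1},\dots,Y_1)$ is $\mathbf{X}$ and $(Y_{i-1},\dots,Y_1)$ is empty. *)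

theory Defs
  imports "HOL-Probability.Probability"
begin

text \<open>
  A random vector is the list of its components, real-valued functions on a common probability
  space; hence \<open>(X, Z)\<close> is \<open>X @ Z\<close>. Since list indices start at \<open>0\<close>, the vector
  \<open>(Y\<^sub>i, \<dots>, Y\<^sub>1)\<close> of the first \<open>i\<close> components of \<open>Y\<close> is \<open>rev (take i Y)\<close>.
\<close>

type_synonym 'a rvec = "('a \<Rightarrow> real) list"

definition random_vector :: "'a measure \<Rightarrow> 'a rvec \<Rightarrow> bool" where
  "random_vector M X \<longleftrightarrow> X \<noteq> [] \<and> (\<forall>V\<in>set X. V \<in> borel_measurable M)"

text \<open>\<open>\<real>\<^sup>n\<close> with its Borel sets; points are functions that are \<open>undefined\<close> outside \<open>{..<n}\<close>.\<close>

abbreviation borel_Rn :: "nat \<Rightarrow> (nat \<Rightarrow> real) measure" where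
  "borel_Rn n \<equiv> PiM {..<n} (\<lambda>_. borel)"

definition vec_map :: "'a rvec \<Rightarrow> 'a \<Rightarrow> nat \<Rightarrow> real" where
  "vec_map X \<omega> = (\<lambda>i\<in>{..<length X}. (X ! i) \<omega>)"

definition sigma_gen :: "'a measure \<Rightarrow> 'a rvec \<Rightarrow> 'a measure" where
  "sigma_gen M X = vimage_algebra (space M) (vec_map X) (borel_Rn (length X))"

definition cond_prob_given :: "'a measure \<Rightarrow> 'a set \<Rightarrow> 'a rvec \<Rightarrow> 'a \<Rightarrow> real" where
  "cond_prob_given M A X = real_cond_exp M (sigma_gen M X) (indicator A)"

definition nondegenerate :: "'a measure \<Rightarrow> ('a \<Rightarrow> real) \<Rightarrow> bool" where
  "nondegenerate M V \<longleftrightarrow> \<not> (\<exists>c. AE \<omega> in M. V \<omega> = c)"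

definition xi :: "'a measure \<Rightarrow> ('a \<Rightarrow> real) \<Rightarrow> 'a rvec \<Rightarrow> real" where
  "xi M V X =
    (if X = [] then 0
     else (\<integral>y. prob_space.variance M (cond_prob_given M {\<omega>\<in>space M. V \<omega> \<ge> y} X) \<partial>distr M borel V)
        / (\<integral>y. prob_space.variance M (indicator {\<omega>\<in>space M. V \<omega> \<ge> y} :: 'a \<Rightarrow> real) \<partial>distr M borel V))"

definition T :: "'a measure \<Rightarrow> 'a rvec \<Rightarrow> 'a rvec \<Rightarrow> real" where
  "T M Y X =
    1 - (real (length Y) - (\<Sum>i<length Y. xi M (Y ! i) (X @ rev (take i Y))))
      / (real (length Y) - (\<Sum>i<length Y. xi M (Y ! i) (rev (take i Y))))"

definition indep_vectors :: "'a measure \<Rightarrow> 'a rvec \<Rightarrow> 'a rvec \<Rightarrow> bool" where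
  "indep_vectors M Y X \<longleftrightarrow>
    prob_space.indep_var M (borel_Rn (length Y)) (vec_map Y) (borel_Rn (length X)) (vec_map X)"

definition perfectly_dependent :: "'a measure \<Rightarrow> 'a rvec \<Rightarrow> 'a rvec \<Rightarrow> bool" where
  "perfectly_dependent M Y X \<longleftrightarrow>
    (\<exists>f \<in> borel_Rn (length X) \<rightarrow>\<^sub>M borel_Rn (length Y).
      AE \<omega> in M. vec_map Y \<omega> = f (vec_map X \<omega>))"

definition cond_indep_given :: "'a measure \<Rightarrow> 'a rvec \<Rightarrow> 'a rvec \<Rightarrow> 'a rvec \<Rightarrow> bool" where
  "cond_indep_given M Y Z X \<longleftrightarrow>
    (\<forall>A\<in>sets (borel_Rn (length Y)). \<forall>B\<in>sets (borel_Rn (length Z)).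
      AE \<omega> in M.
        cond_prob_given M {\<omega>\<in>space M. vec_map Y \<omega> \<in> A \<and> vec_map Z \<omega> \<in> B} X \<omega> =
        cond_prob_given M {\<omega>\<in>space M. vec_map Y \<omega> \<in> A} X \<omega> *
        cond_prob_given M {\<omega>\<in>space M. vec_map Z \<omega> \<in> B} X \<omega>)"

end

theory Submission
  imports Defs
begin

text \<open>
  For sub-sigma-algebras \<open>F \<subseteq> G\<close> the identity
  \<open>Var (P(A | G)) - Var (P(A | F)) = E[(P(A | G) - P(A | F))\<^sup>2]\<close> shows that \<open>\<xi>(V, \<cdot>)\<close> increases
  with the conditioning sigma-algebra, and that it stays constant from \<open>F\<close> to \<open>G\<close> iff
  \<open>P(V \<ge> y | G) = P(V \<ge> y | F)\<close> almost surely, first for \<open>P\<^sup>V\<close>-almost all and then for all \<open>y\<close>.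
  Summing over the components, \<open>T(Y, X) = T(Y, (X, Z))\<close> iff every \<open>Y\<^sub>i\<close> is conditionally independent of
  \<open>Z\<close> given \<open>(X, Y\<^sub>1, \<dots>, Y\<^sub>i\<^sub>-\<^sub>1)\<close>, which by the chain rule (contraction and weak union) is conditional
  independence of \<open>Y\<close> and \<open>Z\<close> given \<open>X\<close>. The empty vector has \<open>T(Y, []) = 0\<close>, so \<open>T \<ge> 0\<close> and (A2) are
  the case of an empty \<open>X\<close>. Likewise \<open>T(Y, X) = 1\<close> iff conditioning on all events instead of
  \<open>(X, Y\<^sub>1, \<dots>, Y\<^sub>i\<^sub>-\<^sub>1)\<close> changes nothing; the same chain rule then makes every event \<open>Y\<^sub>i \<ge> y\<close> almost surely
  an event of \<open>X\<close>, and \<open>Y\<^sub>i\<close> is the supremum of the rational \<open>y\<close> for which this event occurs.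
\<close>

section \<open>Conditional probabilities given a sub-sigma-algebra\<close>

context prob_space
begin

abbreviation cond_pr :: "'a measure \<Rightarrow> 'a set \<Rightarrow> 'a \<Rightarrow> real" where
  "cond_pr F A \<equiv> real_cond_exp M F (indicator A)"

lemma sigma_finite_subalgebraI: "subalgebra M F \<Longrightarrow> sigma_finite_subalgebra M F"
  by (intro finite_measure_subalgebra_is_sigma_finite finite_measure_subalgebra.intro
      finite_measure_subalgebra_axioms.intro finite_measure_axioms)

lemma integrable_indicator_event [simp]: "A \<in> events \<Longrightarrow> integrable M (indicator A :: 'a \<Rightarrow> real)"
  by (simp add: integrable_indicator_iff less_top[symmetric])

lemma integrable_cond_pr:
  assumes "subalgebra M F" "A \<in> events"
  shows "integrable M (cond_pr F A)"
  using assms by (intro sigma_finite_subalgebra.real_cond_exp_int sigma_finite_subalgebraI) simp_all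

lemma cond_pr_bounds:
  assumes "subalgebra M F" "A \<in> events"
  shows "AE \<omega> in M. 0 \<le> cond_pr F A \<omega> \<and> cond_pr F A \<omega> \<le> 1"
proof -
  interpret F: sigma_finite_subalgebra M F by (rule sigma_finite_subalgebraI[OF assms(1)])
  have "AE \<omega> in M. 0 \<le> cond_pr F A \<omega>"
    using assms by (intro F.real_cond_exp_ge_c) simp_all
  moreover have "AE \<omega> in M. cond_pr F A \<omega> \<le> 1"
    using assms by (intro F.real_cond_exp_le_c) (simp_all add: indicator_def)
  ultimately show ?thesis by eventually_elim simp
qed

lemma cond_pr_abs_le:
  assumes "subalgebra M F" "A \<in> events"
  shows "AE \<omega> in M. \<bar>cond_pr F A \<omega>\<bar> \<le> 1"
  using cond_pr_bounds[OF assms] by eventually_elim simp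

lemma integrable_mult_bounded:
  fixes f g :: "'a \<Rightarrow> real"
  assumes "integrable M f" "g \<in> borel_measurable M" "AE \<omega> in M. \<bar>g \<omega>\<bar> \<le> 1"
  shows "integrable M (\<lambda>\<omega>. f \<omega> * g \<omega>)"
proof (rule Bochner_Integration.integrable_bound[OF assms(1)])
  show "(\<lambda>\<omega>. f \<omega> * g \<omega>) \<in> borel_measurable M"
    using assms by measurable
  show "AE \<omega> in M. norm (f \<omega> * g \<omega>) \<le> norm (f \<omega>)"
    using assms(3) by eventually_elim (simp add: abs_mult mult_left_le)
qed

lemma integrable_mult_indicator':
  fixes f :: "'a \<Rightarrow> real"
  assumes "integrable M f" "A \<in> events"
  shows "integrable M (\<lambda>\<omega>. f \<omega> * indicator A \<omega>)"
  using assms by (intro integrable_mult_bounded) (simp_all add: indicator_def)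

lemma integrable_mult_cond_pr:
  fixes f :: "'a \<Rightarrow> real"
  assumes "integrable M f" "subalgebra M F" "A \<in> events"
  shows "integrable M (\<lambda>\<omega>. f \<omega> * cond_pr F A \<omega>)"
  using assms by (intro integrable_mult_bounded cond_pr_abs_le) simp_all

lemma expectation_indicator_mult:
  assumes "A \<in> events" "B \<in> events"
  shows "expectation (\<lambda>\<omega>. indicator A \<omega> * indicator B \<omega> :: real) = prob (A \<inter> B)"
  using assms by (simp add: indicator_inter_arith[symmetric])

lemma expectation_mult_cond_pr:
  assumes "subalgebra M F" "B \<in> events" "h \<in> borel_measurable F" "integrable M h"
  shows "expectation (\<lambda>\<omega>. h \<omega> * cond_pr F B \<omega>) = expectation (\<lambda>\<omega>. h \<omega> * indicator B \<omega>)"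
proof -
  interpret F: sigma_finite_subalgebra M F by (rule sigma_finite_subalgebraI[OF assms(1)])
  show ?thesis
    using assms by (intro F.real_cond_exp_intg integrable_mult_indicator') simp_all
qed

lemma expectation_cond_pr_mult_cond_pr:
  assumes "subalgebra M F" "A \<in> events" "B \<in> events"
  shows "expectation (\<lambda>\<omega>. cond_pr F A \<omega> * cond_pr F B \<omega>)
    = expectation (\<lambda>\<omega>. cond_pr F A \<omega> * indicator B \<omega>)"
  using assms by (intro expectation_mult_cond_pr integrable_cond_pr) simp_all

lemma expectation_cond_pr:
  assumes "subalgebra M F" "A \<in> events"
  shows "expectation (cond_pr F A) = prob A"
  using assms sigma_finite_subalgebra.real_cond_exp_int(2)[OF sigma_finite_subalgebraI[OF assms(1)], of "indicator A"]
  by simp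

lemma cond_pr_charact:
  assumes F: "subalgebra M F" and B: "B \<in> events" and g: "g \<in> borel_measurable F" "integrable M g"
    and eq: "\<And>C. C \<in> sets F \<Longrightarrow> expectation (\<lambda>\<omega>. g \<omega> * indicator C \<omega>) = prob (B \<inter> C)"
  shows "AE \<omega> in M. cond_pr F B \<omega> = g \<omega>"
proof -
  interpret F: sigma_finite_subalgebra M F by (rule sigma_finite_subalgebraI[OF F])
  show ?thesis
  proof (rule F.real_cond_exp_charact)
    fix C assume C: "C \<in> sets F"
    then have "C \<in> events" using F by (auto simp: subalgebra_def)
    then show "(\<integral>x\<in>C. indicator B x \<partial>M) = (\<integral>x\<in>C. g x \<partial>M)"
      using eq[OF C] B
      by (simp add: set_lebesgue_integral_def mult.commute expectation_indicator_mult)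
  qed (use B g in simp_all)
qed

lemma cond_pr_indicator:
  assumes "subalgebra M F" "A \<in> sets F"
  shows "AE \<omega> in M. cond_pr F A \<omega> = indicator A \<omega>"
  using assms by (intro sigma_finite_subalgebra.real_cond_exp_F_meas sigma_finite_subalgebraI)
    (auto simp: subalgebra_def)

lemma cond_pr_Int:
  assumes F: "subalgebra M F" and A: "A \<in> sets F" and B: "B \<in> events"
  shows "AE \<omega> in M. cond_pr F (A \<inter> B) \<omega> = indicator A \<omega> * cond_pr F B \<omega>"
proof -
  interpret F: sigma_finite_subalgebra M F by (rule sigma_finite_subalgebraI[OF F])
  have "A \<in> events" using F A by (auto simp: subalgebra_def)
  then have "AE \<omega> in M. real_cond_exp M F (\<lambda>\<omega>. indicator A \<omega> * indicator B \<omega>) \<omega>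
      = indicator A \<omega> * cond_pr F B \<omega>"
    using A B by (intro F.real_cond_exp_mult integrable_mult_indicator') simp_all
  then show ?thesis
    by (simp add: indicator_inter_arith[symmetric])
qed

lemma cond_pr_cong_AE:
  assumes F: "subalgebra M F" and "A \<in> events" "B \<in> events"
    and "AE \<omega> in M. \<omega> \<in> A \<longleftrightarrow> \<omega> \<in> B"
  shows "AE \<omega> in M. cond_pr F A \<omega> = cond_pr F B \<omega>"
  using assms
  by (intro sigma_finite_subalgebra.real_cond_exp_cong sigma_finite_subalgebraI)
    (auto simp: indicator_def)

text \<open>Dynkin's pi-lambda argument: the events with equal integrals are closed under
  complements and disjoint countable unions. Complements need equal total integrals of
  \<open>f\<close> and \<open>g\<close>, which \<open>space M \<in> P\<close> supplies.\<close>

lemma expectation_indicator_eq_sigma_sets: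
  fixes f g :: "'a \<Rightarrow> real"
  assumes f: "integrable M f" and g: "integrable M g"
    and P: "Int_stable P" "P \<subseteq> events" "space M \<in> P"
    and eq: "\<And>B. B \<in> P \<Longrightarrow>
      expectation (\<lambda>\<omega>. f \<omega> * indicator B \<omega>) = expectation (\<lambda>\<omega>. g \<omega> * indicator B \<omega>)"
    and B: "B \<in> sigma_sets (space M) P"
  shows "expectation (\<lambda>\<omega>. f \<omega> * indicator B \<omega>) = expectation (\<lambda>\<omega>. g \<omega> * indicator B \<omega>)"
proof -
  have P_sub: "P \<subseteq> Pow (space M)" using P(2) sets.sets_into_space by auto
  have ev: "sigma_sets (space M) P \<subseteq> events" by (rule sets.sigma_sets_subset[OF P(2)])
  show ?thesis
    using P(1) P_sub B
  proof (induction rule: sigma_sets_induct_disjoint)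
    case (basic A)
    then show ?case by (rule eq)
  next
    case empty
    then show ?case by simp
  next
    case (compl A)
    have A: "A \<in> events" using compl ev by auto
    have *: "expectation (\<lambda>\<omega>. h \<omega> * indicator (space M - A) \<omega>)
        = expectation (\<lambda>\<omega>. h \<omega> * indicator (space M) \<omega>) - expectation (\<lambda>\<omega>. h \<omega> * indicator A \<omega>)"
      if h: "integrable M h" for h :: "'a \<Rightarrow> real"
    proof -
      have "expectation (\<lambda>\<omega>. h \<omega> * indicator (space M - A) \<omega>)
          = expectation (\<lambda>\<omega>. h \<omega> * indicator (space M) \<omega> - h \<omega> * indicator A \<omega>)"
        using A[THEN sets.sets_into_space]
        by (intro Bochner_Integration.integral_cong) (auto simp: indicator_def)
      also have "\<dots> = expectation (\<lambda>\<omega>. h \<omega> * indicator (space M) \<omega>)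
          - expectation (\<lambda>\<omega>. h \<omega> * indicator A \<omega>)"
        using h A by (intro Bochner_Integration.integral_diff integrable_mult_indicator') simp_all
      finally show ?thesis .
    qed
    show ?case using *[OF f] *[OF g] eq[OF P(3)] compl by simp
  next
    case (union A)
    have A: "\<And>i. A i \<in> events" using union ev by auto
    have *: "expectation (\<lambda>\<omega>. h \<omega> * indicator (\<Union>i. A i) \<omega>)
        = (\<Sum>i. expectation (\<lambda>\<omega>. h \<omega> * indicator (A i) \<omega>))"
      if h: "integrable M h" for h :: "'a \<Rightarrow> real"
    proof -
      have "(\<integral>x\<in>(\<Union>i. A i). h x \<partial>M) = (\<Sum>i. (\<integral>x\<in>A i. h x \<partial>M))"
        using A union(1) h integrable_mult_indicator'[OF h, of "\<Union>i. A i"]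
        by (intro lebesgue_integral_countable_add)
          (auto simp: disjoint_family_on_def set_integrable_def mult.commute)
      then show ?thesis by (simp add: set_lebesgue_integral_def mult.commute)
    qed
    show ?case using *[OF f] *[OF g] union by simp
  qed
qed

text \<open>\<open>cond_pr F B\<close> is a version of \<open>cond_pr G B\<close> iff it has the
  right integral over every \<open>C\<close> in \<open>G\<close>. Since it is
  \<open>F\<close>-measurable, the indicator of \<open>C\<close> may be replaced by
  \<open>cond_pr F C\<close>, which makes the criterion symmetric in \<open>B\<close> and
  \<open>C\<close>.\<close>

lemma cond_pr_eq_iff:
  assumes G: "subalgebra M G" and FG: "subalgebra G F" and B: "B \<in> events"
  shows "(AE \<omega> in M. cond_pr G B \<omega> = cond_pr F B \<omega>) \<longleftrightarrow>
    (\<forall>C\<in>sets G. expectation (\<lambda>\<omega>. cond_pr F B \<omega> * cond_pr F C \<omega>) = prob (B \<inter> C))"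
proof -
  have F: "subalgebra M F" using G FG by (auto simp: subalgebra_def)
  have ev: "C \<in> events" if "C \<in> sets G" for C using G that by (auto simp: subalgebra_def)
  have *: "expectation (\<lambda>\<omega>. cond_pr F B \<omega> * cond_pr F C \<omega>)
      = expectation (\<lambda>\<omega>. cond_pr F B \<omega> * indicator C \<omega>)" if "C \<in> sets G" for C
    using expectation_cond_pr_mult_cond_pr[OF F B ev[OF that]] .
  show ?thesis
  proof (intro iffI ballI)
    fix C assume eq: "AE \<omega> in M. cond_pr G B \<omega> = cond_pr F B \<omega>" and C: "C \<in> sets G"
    have "expectation (\<lambda>\<omega>. cond_pr F B \<omega> * indicator C \<omega>)
        = expectation (\<lambda>\<omega>. indicator C \<omega> * cond_pr G B \<omega>)"
      using eq B C F G ev[OF C] by (intro integral_cong_AE) (auto)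
    also have "\<dots> = expectation (\<lambda>\<omega>. indicator C \<omega> * indicator B \<omega>)"
      using C B G ev[OF C] by (intro expectation_mult_cond_pr) simp_all
    finally show "expectation (\<lambda>\<omega>. cond_pr F B \<omega> * cond_pr F C \<omega>) = prob (B \<inter> C)"
      using *[OF C] B ev[OF C] by (simp add: expectation_indicator_mult Int_commute)
  next
    assume "\<forall>C\<in>sets G. expectation (\<lambda>\<omega>. cond_pr F B \<omega> * cond_pr F C \<omega>) = prob (B \<inter> C)"
    then show "AE \<omega> in M. cond_pr G B \<omega> = cond_pr F B \<omega>"
      using B F *
      by (intro cond_pr_charact[OF G B] integrable_cond_pr measurable_from_subalg[OF FG]
          borel_measurable_cond_exp) auto
  qed
qed

text \<open>
  This integrated form is symmetric in \<open>G\<close> and \<open>K\<close>. It amounts to conditional independence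
  of \<open>G\<close> and \<open>K\<close> given \<open>F\<close> only if \<open>F\<close> is contained in \<open>G\<close> or in \<open>K\<close>.
\<close>

definition cond_indep_alg :: "'a measure \<Rightarrow> 'a measure \<Rightarrow> 'a measure \<Rightarrow> bool" where
  "cond_indep_alg F G K \<longleftrightarrow> (\<forall>B\<in>sets G. \<forall>C\<in>sets K.
    expectation (\<lambda>\<omega>. cond_pr F B \<omega> * cond_pr F C \<omega>) = prob (B \<inter> C))"

lemma cond_indep_alg_commute: "cond_indep_alg F G K \<longleftrightarrow> cond_indep_alg F K G"
  unfolding cond_indep_alg_def by (subst mult.commute, subst Int_commute) blast

text \<open>Because \<open>F\<close> is contained in \<open>G\<close>, the symmetric criterion is
  the usual one-sided statement that \<open>G\<close> tells no more about \<open>K\<close> than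
  \<open>F\<close> does.\<close>

lemma cond_indep_alg_iff_cond_pr:
  assumes "subalgebra M G" "subalgebra G F" "subalgebra M K"
  shows "cond_indep_alg F G K \<longleftrightarrow> (\<forall>C\<in>sets K. AE \<omega> in M. cond_pr G C \<omega> = cond_pr F C \<omega>)"
proof -
  have "(AE \<omega> in M. cond_pr G C \<omega> = cond_pr F C \<omega>) \<longleftrightarrow>
    (\<forall>B\<in>sets G. expectation (\<lambda>\<omega>. cond_pr F B \<omega> * cond_pr F C \<omega>) = prob (B \<inter> C))"
    if "C \<in> sets K" for C
    using cond_pr_eq_iff[OF assms(1,2), of C] that assms(3)
    by (auto simp: subalgebra_def mult.commute Int_commute)
  then show ?thesis unfolding cond_indep_alg_def by blast
qed

lemma cond_indep_alg_antimono:
  "cond_indep_alg F G K' \<Longrightarrow> sets K \<subseteq> sets K' \<Longrightarrow> cond_indep_alg F G K"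
  unfolding cond_indep_alg_def by blast

end

section \<open>Joins of sigma-algebras and conditional independence\<close>

definition algebra_join :: "'a measure \<Rightarrow> 'a measure \<Rightarrow> 'a measure" where
  "algebra_join G K = sigma (space G) (sets G \<union> sets K)"

lemma space_algebra_join: "space (algebra_join G K) = space G"
  unfolding algebra_join_def by (simp add: space_measure_of_conv)

lemma sets_algebra_join:
  assumes "space K = space G"
  shows "sets (algebra_join G K) = sigma_sets (space G) (sets G \<union> sets K)"
  unfolding algebra_join_def using sets.sets_into_space[of _ G] sets.sets_into_space[of _ K] assms
  by (intro sets_measure_of) auto

text \<open>For an intersection-stable \<open>P\<close> the sets \<open>A \<inter> B\<close> form an
  intersection-stable generator, as pi-lambda arguments require; the union of the two algebras need
  not be one. With the whole space in \<open>P\<close>, every set of \<open>G\<close> is itself of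
  this form.\<close>

lemma sets_algebra_join_Int:
  assumes sp: "space K = space G" and P: "sets K = sigma_sets (space G) P" "space G \<in> P"
  shows "sets (algebra_join G K) = sigma_sets (space G) {A \<inter> B | A B. A \<in> sets G \<and> B \<in> P}"
    (is "_ = sigma_sets _ ?I")
proof -
  have PK: "P \<subseteq> sets K" unfolding P by auto
  have Psp: "B \<subseteq> space G" if "B \<in> P" for B using PK that sets.sets_into_space sp by blast
  have "sigma_sets (space G) (sets G \<union> sets K) = sigma_sets (space G) ?I"
  proof (rule sigma_sets_eqI)
    fix A assume "A \<in> sets G \<union> sets K"
    then show "A \<in> sigma_sets (space G) ?I"
    proof
      assume A: "A \<in> sets G"
      then have "A = A \<inter> space G" using sets.sets_into_space by auto
      then show ?thesis using A P(2) by (intro sigma_sets.Basic) blast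
    next
      assume "A \<in> sets K"
      moreover have "P \<subseteq> ?I"
        using Psp sets.top[of G] by (blast intro: Int_absorb1[symmetric])
      ultimately show ?thesis unfolding P(1)
        using sigma_sets_mono'[of P ?I "space G"] by auto
    qed
  next
    interpret J: sigma_algebra "space G" "sigma_sets (space G) (sets G \<union> sets K)"
      using sets.sets_into_space[of _ G] sets.sets_into_space[of _ K] sp
      by (intro sigma_algebra_sigma_sets) auto
    fix C assume "C \<in> ?I"
    then show "C \<in> sigma_sets (space G) (sets G \<union> sets K)"
      using PK by (auto intro!: J.Int)
  qed
  then show ?thesis using sets_algebra_join[OF sp] by simp
qed

lemma subalgebra_algebra_join:
  assumes "subalgebra M G" "subalgebra M K"
  shows "subalgebra M (algebra_join G K)"
proof -
  have "sigma_sets (space M) (sets G \<union> sets K) \<subseteq> sets M"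
    using assms by (intro sets.sigma_sets_subset) (auto simp: subalgebra_def)
  then show ?thesis
    using assms by (simp add: subalgebra_def space_algebra_join sets_algebra_join)
qed

lemma subalgebra_algebra_join1:
  "space K = space G \<Longrightarrow> subalgebra (algebra_join G K) G"
  and subalgebra_algebra_join2:
  "space K = space G \<Longrightarrow> subalgebra (algebra_join G K) K"
  by (auto simp: subalgebra_def space_algebra_join sets_algebra_join)

lemma subalgebra_trans: "subalgebra M G \<Longrightarrow> subalgebra G F \<Longrightarrow> subalgebra M F"
  by (auto simp: subalgebra_def)

lemma Int_stable_Int:
  assumes "Int_stable P" "Int_stable Q"
  shows "Int_stable {A \<inter> B | A B. A \<in> P \<and> B \<in> Q}"
proof (rule Int_stableI)
  fix C D assume "C \<in> {A \<inter> B | A B. A \<in> P \<and> B \<in> Q}" "D \<in> {A \<inter> B | A B. A \<in> P \<and> B \<in> Q}"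
  then obtain A B A' B' where *: "C = A \<inter> B" "D = A' \<inter> B'" "A \<in> P" "A' \<in> P" "B \<in> Q" "B' \<in> Q"
    by blast
  show "C \<inter> D \<in> {A \<inter> B | A B. A \<in> P \<and> B \<in> Q}"
    unfolding mem_Collect_eq
  proof (intro exI conjI)
    show "C \<inter> D = (A \<inter> A') \<inter> (B \<inter> B')" using * by blast
    show "A \<inter> A' \<in> P" "B \<inter> B' \<in> Q"
      using * Int_stableD[OF assms(1)] Int_stableD[OF assms(2)] by auto
  qed
qed

lemma Int_stable_sets: "Int_stable (sets G)"
  by (auto intro: Int_stableI)

section \<open>Rules for conditional independence: generators, contraction, weak union\<close>

context prob_space
begin

text \<open>For fixed \<open>B\<close>, the pi-lambda argument compares the integrals of
  \<open>cond_pr F B\<close> and of the indicator of \<open>B\<close> over the events of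
  \<open>K\<close>.\<close>

lemma cond_indep_alg_generator:
  assumes F: "subalgebra M F" and G: "subalgebra M G" and P: "Int_stable P" "P \<subseteq> events" "space M \<in> P"
    and K: "sets K = sigma_sets (space M) P"
    and eq: "\<And>B C. B \<in> sets G \<Longrightarrow> C \<in> P \<Longrightarrow>
      expectation (\<lambda>\<omega>. cond_pr F B \<omega> * cond_pr F C \<omega>) = prob (B \<inter> C)"
  shows "cond_indep_alg F G K"
  unfolding cond_indep_alg_def
proof (intro ballI)
  fix B C assume B: "B \<in> sets G" and C: "C \<in> sets K"
  have B': "B \<in> events" using B G by (auto simp: subalgebra_def)
  have sub: "sigma_sets (space M) P \<subseteq> events" by (rule sets.sigma_sets_subset[OF P(2)])
  have C': "C \<in> events" using C sub K by auto
  have "expectation (\<lambda>\<omega>. cond_pr F B \<omega> * indicator C \<omega>)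
      = expectation (\<lambda>\<omega>. indicator B \<omega> * indicator C \<omega>)"
  proof (rule expectation_indicator_eq_sigma_sets)
    fix D assume D: "D \<in> P"
    then have "D \<in> events" using P by auto
    then show "expectation (\<lambda>\<omega>. cond_pr F B \<omega> * indicator D \<omega>)
        = expectation (\<lambda>\<omega>. indicator B \<omega> * indicator D \<omega>)"
      using eq[OF B D] B' F by (simp add: expectation_indicator_mult expectation_cond_pr_mult_cond_pr)
  qed (use F B' P C K in \<open>auto intro: integrable_cond_pr\<close>)
  then show "expectation (\<lambda>\<omega>. cond_pr F B \<omega> * cond_pr F C \<omega>) = prob (B \<inter> C)"
    using B' C' F by (simp add: expectation_indicator_mult expectation_cond_pr_mult_cond_pr)
qed

text \<open>On a generating set \<open>A \<inter> D\<close> with \<open>A\<close> in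
  \<open>F\<close> and \<open>D\<close> in \<open>P\<close>, the indicator of \<open>A\<close>
  factors out of both conditional probabilities, since \<open>A\<close> also belongs to
  \<open>G\<close>. Equality on \<open>P\<close> thus suffices for the whole join.\<close>

lemma cond_indep_alg_join:
  assumes G: "subalgebra M G" and FG: "subalgebra G F" and L: "subalgebra M L"
    and P: "Int_stable P" "space M \<in> P" "sets L = sigma_sets (space M) P"
    and eq: "\<And>B. B \<in> P \<Longrightarrow> AE \<omega> in M. cond_pr G B \<omega> = cond_pr F B \<omega>"
  shows "cond_indep_alg F G (algebra_join F L)"
proof (rule cond_indep_alg_generator)
  have F: "subalgebra M F" using G FG by (rule subalgebra_trans)
  then show "subalgebra M F" "subalgebra M G" using G .
  have PL: "P \<subseteq> sets L" using P by auto
  have Pev: "P \<subseteq> events" using PL L by (auto simp: subalgebra_def)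
  let ?I = "{A \<inter> B | A B. A \<in> sets F \<and> B \<in> P}"
  show "Int_stable ?I" by (intro Int_stable_Int P Int_stable_sets)
  show "?I \<subseteq> events" using Pev F by (auto simp: subalgebra_def)
  have sp: "space F = space M" "space L = space M" using F L by (simp_all add: subalgebra_def)
  show "space M \<in> ?I"
    unfolding mem_Collect_eq using P(2) sets.top[of F] sp
    by (intro exI[of _ "space M"] conjI) (simp_all only: Int_absorb)
  show "sets (algebra_join F L) = sigma_sets (space M) ?I"
    using sets_algebra_join_Int[of L F P, unfolded sp, OF refl P(3,2)] .
  fix B C assume B: "B \<in> sets G" and "C \<in> ?I"
  then obtain A D where C: "C = A \<inter> D" and A: "A \<in> sets F" and D: "D \<in> P" by auto
  have ev: "A \<in> events" "D \<in> events" using A D F Pev by (auto simp: subalgebra_def)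
  have AG: "A \<in> sets G" using A FG by (auto simp: subalgebra_def)
  have "AE \<omega> in M. cond_pr G C \<omega> = cond_pr F C \<omega>"
    using eq[OF D] cond_pr_Int[OF F A ev(2)] cond_pr_Int[OF G AG ev(2)] unfolding C
    by eventually_elim simp
  moreover have "C \<in> events" using ev C by simp
  ultimately have "expectation (\<lambda>\<omega>. cond_pr F C \<omega> * cond_pr F B \<omega>) = prob (C \<inter> B)"
    using cond_pr_eq_iff[OF G FG] B by blast
  then show "expectation (\<lambda>\<omega>. cond_pr F B \<omega> * cond_pr F C \<omega>) = prob (B \<inter> C)"
    by (simp only: mult.commute Int_commute)
qed

text \<open>The contraction rule. \<open>G\<close> is joined with \<open>K\<close> in the second
  hypothesis so that the conditioning algebra \<open>K\<close> is contained in one side, where the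
  integrated form does mean conditional independence.\<close>

lemma cond_indep_alg_contraction:
  assumes G: "subalgebra M G" and K': "subalgebra M K'"
    and FG: "subalgebra G F" and FK: "subalgebra K F" and KK': "subalgebra K' K"
    and 1: "cond_indep_alg F G K" and 2: "cond_indep_alg K (algebra_join G K) K'"
  shows "cond_indep_alg F G K'"
  unfolding cond_indep_alg_def
proof (intro ballI)
  fix C B assume C: "C \<in> sets G" and B: "B \<in> sets K'"
  have K: "subalgebra M K" and F: "subalgebra M F"
    using subalgebra_trans K' KK' FK by blast+
  have sp: "space K = space G" using K G by (simp add: subalgebra_def)
  have CJ: "C \<in> sets (algebra_join G K)" using subalgebra_algebra_join1[OF sp] C by (auto simp: subalgebra_def)
  have ev: "C \<in> events" "B \<in> events" using B C G K' by (auto simp: subalgebra_def)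
  have eq: "AE \<omega> in M. cond_pr K C \<omega> = cond_pr F C \<omega>"
    using 1 C cond_indep_alg_iff_cond_pr[OF K FK G] by (simp add: cond_indep_alg_commute)
  have "prob (C \<inter> B) = expectation (\<lambda>\<omega>. cond_pr K C \<omega> * cond_pr K B \<omega>)"
    using 2 B CJ by (simp add: cond_indep_alg_def)
  also have "\<dots> = expectation (\<lambda>\<omega>. cond_pr F C \<omega> * cond_pr K B \<omega>)"
    using eq by (intro integral_cong_AE) auto
  \<comment> \<open>\<open>cond_pr F C\<close> is also \<open>K\<close>-measurable, so the
    conditioning of \<open>B\<close> on \<open>K\<close> can be undone and then redone on
    \<open>F\<close>.\<close>
  also have "\<dots> = expectation (\<lambda>\<omega>. cond_pr F C \<omega> * indicator B \<omega>)"
    using F ev by (intro expectation_mult_cond_pr K integrable_cond_pr measurable_from_subalg[OF FK]) auto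
  also have "\<dots> = expectation (\<lambda>\<omega>. cond_pr F C \<omega> * cond_pr F B \<omega>)"
    using F ev by (simp add: expectation_cond_pr_mult_cond_pr)
  finally show "expectation (\<lambda>\<omega>. cond_pr F C \<omega> * cond_pr F B \<omega>) = prob (C \<inter> B)" ..
qed

text \<open>For \<open>C\<close> in \<open>G\<close>, the conditional probabilities of
  \<open>C\<close> given \<open>K'\<close> and given the intermediate \<open>K\<close> both equal
  the one given \<open>F\<close>, hence each other. \<open>cond_indep_alg_join\<close> then adds
  \<open>K\<close> to \<open>G\<close>.\<close>

lemma cond_indep_alg_weak_union:
  assumes G: "subalgebra M G" and K': "subalgebra M K'"
    and FG: "subalgebra G F" and FK: "subalgebra K F" and KK': "subalgebra K' K"
    and 1: "cond_indep_alg F G K'"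
  shows "cond_indep_alg K (algebra_join G K) K'"
proof -
  have K: "subalgebra M K" and F: "subalgebra M F" and FK': "subalgebra K' F"
    using subalgebra_trans K' KK' FK by blast+
  have sp: "space K = space G" "space G = space M" using K G by (simp_all add: subalgebra_def)
  have "cond_indep_alg F G K" using 1 KK' by (auto simp: cond_indep_alg_def subalgebra_def)
  then have "AE \<omega> in M. cond_pr K' C \<omega> = cond_pr K C \<omega>" if C: "C \<in> sets G" for C
    using 1 C cond_indep_alg_iff_cond_pr[OF K FK G] cond_indep_alg_iff_cond_pr[OF K' FK' G]
    by (force simp: cond_indep_alg_commute)
  then have "cond_indep_alg K K' (algebra_join K G)"
    using sp sets.sigma_sets_eq[of G] sets.top[of G]
    by (intro cond_indep_alg_join[OF K' KK' G Int_stable_sets]) auto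
  moreover have "algebra_join K G = algebra_join G K"
    using sp by (simp add: algebra_join_def Un_commute)
  ultimately show ?thesis by (simp add: cond_indep_alg_commute)
qed

text \<open>One link of the chain rule: weak union gives one direction and contraction the other,
  with \<open>P\<close> reducing the new condition to generators of \<open>L\<close>. Only the sets
  of \<open>K'\<close> are prescribed, which is all that \<open>cond_indep_alg\<close> reads from
  its last argument.\<close>

lemma cond_indep_alg_step:
  assumes G: "subalgebra M G" and K: "subalgebra M K" and L: "subalgebra M L"
    and FG: "subalgebra G F" and FK: "subalgebra K F"
    and K': "sets K' = sets (algebra_join K L)"
    and P: "Int_stable P" "space M \<in> P" "sets L = sigma_sets (space M) P"
  shows "cond_indep_alg F G K' \<longleftrightarrow> cond_indep_alg F G K \<and>
    (\<forall>B\<in>P. AE \<omega> in M. cond_pr (algebra_join G K) B \<omega> = cond_pr K B \<omega>)"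
proof -
  note sp = K[unfolded subalgebra_def] L[unfolded subalgebra_def] G[unfolded subalgebra_def]
  have MJ: "subalgebra M (algebra_join K L)" using K L by (rule subalgebra_algebra_join)
  have JK: "subalgebra (algebra_join K L) K" "subalgebra (algebra_join K L) L"
    using sp by (auto intro: subalgebra_algebra_join1 subalgebra_algebra_join2)
  have GK: "subalgebra M (algebra_join G K)" "subalgebra (algebra_join G K) K"
    using sp G K by (auto intro: subalgebra_algebra_join subalgebra_algebra_join2)
  have P_sub: "P \<subseteq> sets (algebra_join K L)" using JK(2) P by (auto simp: subalgebra_def)
  have "cond_indep_alg F G K' \<longleftrightarrow> cond_indep_alg F G (algebra_join K L)"
    using K' by (simp add: cond_indep_alg_def)
  also have "\<dots> \<longleftrightarrow> cond_indep_alg F G K \<and>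
    (\<forall>B\<in>P. AE \<omega> in M. cond_pr (algebra_join G K) B \<omega> = cond_pr K B \<omega>)"
  proof safe
    assume *: "cond_indep_alg F G (algebra_join K L)"
    then show "cond_indep_alg F G K" using JK(1) by (auto simp: cond_indep_alg_def subalgebra_def)
    fix B assume "B \<in> P"
    then show "AE \<omega> in M. cond_pr (algebra_join G K) B \<omega> = cond_pr K B \<omega>"
      using cond_indep_alg_weak_union[OF G MJ FG FK JK(1) *]
        cond_indep_alg_iff_cond_pr[OF GK MJ] P_sub by auto
  next
    assume *: "cond_indep_alg F G K"
      "\<forall>B\<in>P. AE \<omega> in M. cond_pr (algebra_join G K) B \<omega> = cond_pr K B \<omega>"
    have "cond_indep_alg K (algebra_join G K) (algebra_join K L)"
      using * by (intro cond_indep_alg_join[OF GK L P]) auto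
    then show "cond_indep_alg F G (algebra_join K L)"
      by (rule cond_indep_alg_contraction[OF G MJ FG FK JK(1) *(1)])
  qed
  finally show ?thesis .
qed

end

section \<open>Sigma-algebras generated by random vectors\<close>

lemma vec_map_nth: "i < length L \<Longrightarrow> vec_map L \<omega> i = (L ! i) \<omega>"
  by (simp add: vec_map_def)

lemma vec_map_space: "vec_map L \<in> S \<rightarrow> space (borel_Rn (length L))"
  by (auto simp: vec_map_def space_PiM)

lemma measurable_vec_map:
  assumes "\<forall>V\<in>set L. V \<in> borel_measurable N"
  shows "vec_map L \<in> N \<rightarrow>\<^sub>M borel_Rn (length L)"
  unfolding vec_map_def using assms by (intro measurable_restrict) simp

lemma space_sigma_gen [simp]: "space (sigma_gen N L) = space N"
  by (simp add: sigma_gen_def)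

lemma sets_sigma_gen:
  "sets (sigma_gen N L) = {vec_map L -` A \<inter> space N | A. A \<in> sets (borel_Rn (length L))}"
  unfolding sigma_gen_def by (rule sets_vimage_algebra2[OF vec_map_space])

lemma vec_map_measurable_sigma_gen: "vec_map L \<in> sigma_gen N L \<rightarrow>\<^sub>M borel_Rn (length L)"
  unfolding sigma_gen_def by (rule measurable_vimage_algebra1[OF vec_map_space])

lemma component_measurable_sigma_gen:
  assumes "V \<in> set L"
  shows "V \<in> borel_measurable (sigma_gen N L)"
proof -
  obtain i where i: "i < length L" "V = L ! i" using assms by (auto simp: in_set_conv_nth)
  have "(\<lambda>\<omega>. vec_map L \<omega> i) \<in> borel_measurable (sigma_gen N L)"
    using i by (intro measurable_compose[OF vec_map_measurable_sigma_gen]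
        measurable_component_singleton) simp
  then show ?thesis using i by (simp add: vec_map_nth)
qed

lemma subalgebra_sigma_gen:
  assumes "space N = space N'" "\<forall>V\<in>set L. V \<in> borel_measurable N'"
  shows "subalgebra N' (sigma_gen N L)"
  using sets_image_in_sets[OF refl measurable_vec_map[OF assms(2)]] assms(1)
  by (simp add: subalgebra_def sigma_gen_def)

text \<open>Each component of \<open>L\<close> is measurable for \<open>sigma_gen N L'\<close>. In
  particular order and repetition of components do not matter, so that reversing \<open>Y\<close> or
  repeating \<open>X\<close> is harmless.\<close>

lemma sets_sigma_gen_mono: "set L \<subseteq> set L' \<Longrightarrow> sets (sigma_gen N L) \<subseteq> sets (sigma_gen N L')"
  using subalgebra_sigma_gen[of N "sigma_gen N L'" L] component_measurable_sigma_gen[of _ L' N]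
  by (auto simp: subalgebra_def)

lemma sets_sigma_gen_eqI: "set L = set L' \<Longrightarrow> sets (sigma_gen N L) = sets (sigma_gen N L')"
  using sets_sigma_gen_mono by (metis subset_antisym subset_refl)

lemma sets_sigma_gen_append:
  "sets (sigma_gen N (L @ L')) = sets (algebra_join (sigma_gen N L) (sigma_gen N L'))"
proof
  let ?J = "algebra_join (sigma_gen N L) (sigma_gen N L')"
  have "V \<in> borel_measurable ?J" if "V \<in> set L \<union> set L'" for V
    using that component_measurable_sigma_gen[of V L N] component_measurable_sigma_gen[of V L' N]
    by (auto intro: measurable_from_subalg[OF subalgebra_algebra_join1]
        measurable_from_subalg[OF subalgebra_algebra_join2])
  then show "sets (sigma_gen N (L @ L')) \<subseteq> sets ?J"
    using subalgebra_sigma_gen[of N ?J "L @ L'"] by (simp add: subalgebra_def space_algebra_join)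
  have "sigma_sets (space (sigma_gen N (L @ L'))) (sets (sigma_gen N L) \<union> sets (sigma_gen N L'))
      \<subseteq> sets (sigma_gen N (L @ L'))"
    using sets_sigma_gen_mono[of L "L @ L'" N] sets_sigma_gen_mono[of L' "L @ L'" N]
    by (intro sets.sigma_sets_subset) auto
  then show "sets ?J \<subseteq> sets (sigma_gen N (L @ L'))" by (simp add: sets_algebra_join)
qed

text \<open>Half-lines generate the Borel sets. The whole space is inserted because the pi-lambda
  lemmas ask for it in the generator.\<close>

lemma sets_sigma_gen_singleton:
  "sets (sigma_gen N [V]) = sigma_sets (space N) (insert (space N) (range (\<lambda>y. {\<omega>\<in>space N. y \<le> V \<omega>})))"
    (is "_ = sigma_sets _ ?P")
proof
  have sub: "?P \<subseteq> Pow (space N)" by auto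
  let ?S = "sigma (space N) ?P"
  have "V \<in> borel_measurable ?S"
    unfolding borel_measurable_iff_ge using sub by auto
  then show "sets (sigma_gen N [V]) \<subseteq> sigma_sets (space N) ?P"
    using subalgebra_sigma_gen[of N ?S "[V]"] sub by (simp add: subalgebra_def)
  have [measurable]: "V \<in> borel_measurable (sigma_gen N [V])"
    by (intro component_measurable_sigma_gen) simp
  have "{\<omega>\<in>space N. y \<le> V \<omega>} \<in> sets (sigma_gen N [V])" for y
  proof -
    have "{\<omega>\<in>space (sigma_gen N [V]). y \<le> V \<omega>} \<in> sets (sigma_gen N [V])" by measurable
    then show ?thesis by simp
  qed
  then have "?P \<subseteq> sets (sigma_gen N [V])"
    using sets.top[of "sigma_gen N [V]"] by auto
  then show "sigma_sets (space N) ?P \<subseteq> sets (sigma_gen N [V])"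
    using sets.sigma_sets_subset[of ?P "sigma_gen N [V]"] by simp
qed

lemma Int_stable_ge:
  "Int_stable (insert S (range (\<lambda>y::real. {\<omega>\<in>S. y \<le> V \<omega>})))"
proof (rule Int_stableI)
  fix A B assume A: "A \<in> insert S (range (\<lambda>y. {\<omega>\<in>S. y \<le> V \<omega>}))"
    and B: "B \<in> insert S (range (\<lambda>y. {\<omega>\<in>S. y \<le> V \<omega>}))"
  have "{\<omega>\<in>S. y \<le> V \<omega>} \<inter> {\<omega>\<in>S. z \<le> V \<omega>} = {\<omega>\<in>S. max y z \<le> V \<omega>}" for y z by auto
  moreover have "S \<inter> {\<omega>\<in>S. y \<le> V \<omega>} = {\<omega>\<in>S. y \<le> V \<omega>}"
    "{\<omega>\<in>S. y \<le> V \<omega>} \<inter> S = {\<omega>\<in>S. y \<le> V \<omega>}" for y by auto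
  ultimately show "A \<inter> B \<in> insert S (range (\<lambda>y. {\<omega>\<in>S. y \<le> V \<omega>}))"
    using A B by (elim insertE rangeE) (simp_all only: Int_absorb, blast+)
qed

section \<open>The chain rule over components, and the translation of conditional independence of
  vectors\<close>

context prob_space
begin

abbreviation rvs :: "'a rvec \<Rightarrow> bool" where
  "rvs L \<equiv> \<forall>V\<in>set L. V \<in> borel_measurable M"

lemma subalgebra_M_sigma_gen: "rvs L \<Longrightarrow> subalgebra M (sigma_gen M L)"
  by (rule subalgebra_sigma_gen) simp_all

lemma subalgebra_sigma_gen_mono: "set L \<subseteq> set L' \<Longrightarrow> subalgebra (sigma_gen M L') (sigma_gen M L)"
  using sets_sigma_gen_mono by (simp add: subalgebra_def)

text \<open>\<open>real_cond_exp\<close> takes a measure as argument, and equal sets do not make two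
  measures equal. For \<open>B\<close> in \<open>F\<close> the conditional probability given
  \<open>F'\<close> is the indicator of \<open>B\<close>, so \<open>F\<close> is independent of all
  events given \<open>F'\<close>; the one-sided criterion then gives the claim.\<close>

lemma cond_pr_cong_sets:
  assumes "subalgebra M F" "sets F = sets F'" "A \<in> events"
  shows "AE \<omega> in M. cond_pr F A \<omega> = cond_pr F' A \<omega>"
proof -
  have sp: "space F = space F'" using assms(2) by (rule sets_eq_imp_space_eq)
  then have *: "subalgebra F F'" "subalgebra M F'" using assms by (simp_all add: subalgebra_def)
  have ev: "C \<in> events" if "C \<in> sets F" for C using that assms by (auto simp: subalgebra_def)
  have "cond_indep_alg F' F M"
    unfolding cond_indep_alg_def
  proof (intro ballI)
    fix B C assume B: "B \<in> sets F" and C: "C \<in> events"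
    have "expectation (\<lambda>\<omega>. cond_pr F' B \<omega> * cond_pr F' C \<omega>)
        = expectation (\<lambda>\<omega>. indicator B \<omega> * cond_pr F' C \<omega>)"
    proof (rule integral_cong_AE)
      have "AE \<omega> in M. cond_pr F' B \<omega> = indicator B \<omega>"
        using B assms(2) by (intro cond_pr_indicator *) simp
      then show "AE \<omega> in M. cond_pr F' B \<omega> * cond_pr F' C \<omega> = indicator B \<omega> * cond_pr F' C \<omega>"
        by eventually_elim simp
      have [measurable]: "B \<in> events" using B by (rule ev)
      show "(\<lambda>\<omega>. cond_pr F' B \<omega> * cond_pr F' C \<omega>) \<in> borel_measurable M"
        "(\<lambda>\<omega>. indicator B \<omega> * cond_pr F' C \<omega>) \<in> borel_measurable M" by measurable
    qed
    also have "\<dots> = prob (B \<inter> C)"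
      using B C * ev assms
      by (simp add: expectation_mult_cond_pr expectation_indicator_mult)
    finally show "expectation (\<lambda>\<omega>. cond_pr F' B \<omega> * cond_pr F' C \<omega>) = prob (B \<inter> C)" .
  qed
  then show ?thesis
    using assms * cond_indep_alg_iff_cond_pr[of F F' M] by (simp add: subalgebra_def)
qed

lemma cond_pr_eq_of_mem:
  assumes "subalgebra M F" "A \<in> sets F" "subalgebra M G" "A \<in> sets G"
  shows "AE \<omega> in M. cond_pr G A \<omega> = cond_pr F A \<omega>"
  using cond_pr_indicator[OF assms(1,2)] cond_pr_indicator[OF assms(3,4)]
  by eventually_elim simp

lemma cond_indep_alg_self:
  assumes "subalgebra M G" "subalgebra G F"
  shows "cond_indep_alg F G F"
proof -
  have F: "subalgebra M F" using assms by (rule subalgebra_trans)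
  have "AE \<omega> in M. cond_pr G C \<omega> = cond_pr F C \<omega>" if C: "C \<in> sets F" for C
    using assms(2) C by (intro cond_pr_eq_of_mem F assms(1)) (auto simp: subalgebra_def)
  then show ?thesis using cond_indep_alg_iff_cond_pr[OF assms F] by blast
qed

text \<open>Induction on the number of components, one \<open>cond_indep_alg_step\<close> for each.
  \<open>G\<close> is left general because it is used both for the algebra of \<open>(X, Z)\<close>
  and for \<open>M\<close> itself.\<close>

lemma cond_indep_alg_chain:
  assumes G: "subalgebra M G" "subalgebra G (sigma_gen M X)" and X: "rvs X" and Y: "rvs Y"
    and n: "n \<le> length Y"
  shows "cond_indep_alg (sigma_gen M X) G (sigma_gen M (X @ rev (take n Y))) \<longleftrightarrow>
    (\<forall>i<n. \<forall>y. AE \<omega> in M.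
      cond_pr (algebra_join G (sigma_gen M (X @ rev (take i Y)))) {\<omega>\<in>space M. y \<le> (Y ! i) \<omega>} \<omega>
      = cond_pr (sigma_gen M (X @ rev (take i Y))) {\<omega>\<in>space M. y \<le> (Y ! i) \<omega>} \<omega>)"
  using n
proof (induction n)
  case 0
  then show ?case using cond_indep_alg_self[OF G] by simp
next
  case (Suc n)
  let ?K = "sigma_gen M (X @ rev (take n Y))" and ?V = "Y ! n"
  let ?P = "insert (space M) (range (\<lambda>y. {\<omega>\<in>space M. y \<le> ?V \<omega>}))"
  have rv: "rvs (X @ rev (take n Y))" "rvs [?V]"
    using X Y Suc.prems set_take_subset[of n Y] by (auto intro: nth_mem)
  \<comment> \<open>The reversal puts the new component right after \<open>X\<close> and not at the
    end, so the lists agree only as sets of components.\<close>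
  have K': "sets (sigma_gen M (X @ rev (take (Suc n) Y))) = sets (algebra_join ?K (sigma_gen M [?V]))"
    unfolding sets_sigma_gen_append[symmetric] using Suc.prems
    by (intro sets_sigma_gen_eqI) (auto simp: take_Suc_conv_app_nth)
  have sub: "subalgebra M (algebra_join G ?K)" "subalgebra M ?K"
    using G rv by (auto intro!: subalgebra_algebra_join subalgebra_M_sigma_gen)
  \<comment> \<open>The inserted whole space imposes no condition, which leaves the events
    \<open>y \<le> V\<close>.\<close>
  have "AE \<omega> in M. cond_pr (algebra_join G ?K) (space M) \<omega> = cond_pr ?K (space M) \<omega>"
    using sub by (intro cond_pr_eq_of_mem) (metis sets.top subalgebra_def)+
  then have *: "(\<forall>B\<in>?P. AE \<omega> in M. cond_pr (algebra_join G ?K) B \<omega> = cond_pr ?K B \<omega>) \<longleftrightarrow>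
    (\<forall>y. AE \<omega> in M. cond_pr (algebra_join G ?K) {\<omega>\<in>space M. y \<le> ?V \<omega>} \<omega>
       = cond_pr ?K {\<omega>\<in>space M. y \<le> ?V \<omega>} \<omega>)"
    by auto
  have "cond_indep_alg (sigma_gen M X) G (sigma_gen M (X @ rev (take (Suc n) Y))) \<longleftrightarrow>
    cond_indep_alg (sigma_gen M X) G ?K \<and>
    (\<forall>B\<in>?P. AE \<omega> in M. cond_pr (algebra_join G ?K) B \<omega> = cond_pr ?K B \<omega>)"
    using rv by (intro cond_indep_alg_step[OF G(1) sub(2) subalgebra_M_sigma_gen G(2) _ K' Int_stable_ge])
      (auto simp: sets_sigma_gen_singleton intro!: subalgebra_sigma_gen_mono)
  then show ?case using Suc * by (simp add: All_less_Suc) blast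
qed

text \<open>To test the product against an event \<open>C\<close> of \<open>F\<close>, absorb
  \<open>C\<close> into \<open>B\<close>: the intersection \<open>C \<inter> B\<close> still belongs
  to \<open>G\<close>, so the integrated form applies to it.\<close>

lemma cond_pr_Int_eq:
  assumes G: "subalgebra M G" "subalgebra G F" and K: "subalgebra M K"
    and CI: "cond_indep_alg F G K" and B: "B \<in> sets G" and A: "A \<in> sets K"
  shows "AE \<omega> in M. cond_pr F (A \<inter> B) \<omega> = cond_pr F A \<omega> * cond_pr F B \<omega>"
proof (rule cond_pr_charact)
  show F: "subalgebra M F" using G by (rule subalgebra_trans)
  have ev: "A \<in> events" "B \<in> events" using A B G K by (auto simp: subalgebra_def)
  then show "A \<inter> B \<in> events" by simp
  show "(\<lambda>\<omega>. cond_pr F A \<omega> * cond_pr F B \<omega>) \<in> borel_measurable F" by simp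
  show int: "integrable M (\<lambda>\<omega>. cond_pr F A \<omega> * cond_pr F B \<omega>)"
    using F ev by (intro integrable_mult_cond_pr integrable_cond_pr)
  fix C assume C: "C \<in> sets F"
  then have C': "C \<in> events" "C \<in> sets G" using F G by (auto simp: subalgebra_def)
  have "prob (A \<inter> B \<inter> C) = prob ((C \<inter> B) \<inter> A)" by (simp add: Int_ac)
  also have "\<dots> = expectation (\<lambda>\<omega>. cond_pr F (C \<inter> B) \<omega> * cond_pr F A \<omega>)"
    using CI A B C' by (simp add: cond_indep_alg_def sets.Int)
  also have "\<dots> = expectation (\<lambda>\<omega>. (cond_pr F A \<omega> * cond_pr F B \<omega>) * indicator C \<omega>)"
    using cond_pr_Int[OF F C ev(2)] C' ev by (intro integral_cong_AE) (auto simp: mult_ac elim: AE_mp)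
  finally show "expectation (\<lambda>\<omega>. (cond_pr F A \<omega> * cond_pr F B \<omega>) * indicator C \<omega>) = prob (A \<inter> B \<inter> C)" ..
qed

lemma cond_indep_given_iff_sets:
  "cond_indep_given M Y Z X \<longleftrightarrow>
    (\<forall>A\<in>sets (sigma_gen M Y). \<forall>B\<in>sets (sigma_gen M Z). AE \<omega> in M.
      cond_pr (sigma_gen M X) (A \<inter> B) \<omega> = cond_pr (sigma_gen M X) A \<omega> * cond_pr (sigma_gen M X) B \<omega>)"
proof -
  have 1: "{\<omega>\<in>space M. vec_map Y \<omega> \<in> A \<and> vec_map Z \<omega> \<in> B}
      = (vec_map Y -` A \<inter> space M) \<inter> (vec_map Z -` B \<inter> space M)" for A B by auto
  have 2: "{\<omega>\<in>space M. vec_map L \<omega> \<in> A} = vec_map L -` A \<inter> space M" for L and A by auto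
  show ?thesis
    unfolding cond_indep_given_def cond_prob_given_def sets_sigma_gen 1 2 by auto
qed

text \<open>Appending \<open>X\<close> to both vectors does not affect conditional independence
  given \<open>X\<close>, and it brings the conditioning algebra inside both sides, where the
  integrated form is valid.\<close>

lemma cond_indep_given_iff_alg:
  assumes X: "rvs X" and Y: "rvs Y" and Z: "rvs Z"
  shows "cond_indep_given M Y Z X \<longleftrightarrow>
    cond_indep_alg (sigma_gen M X) (sigma_gen M (X @ Z)) (sigma_gen M (X @ Y))"
proof -
  let ?F = "sigma_gen M X" and ?G = "sigma_gen M (X @ Z)" and ?K = "sigma_gen M (X @ Y)"
  have F: "subalgebra M ?F" and G: "subalgebra M ?G" and K: "subalgebra M ?K"
    and sY: "subalgebra M (sigma_gen M Y)" and sZ: "subalgebra M (sigma_gen M Z)"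
    using X Y Z by (auto intro!: subalgebra_M_sigma_gen)
  have FG: "subalgebra ?G ?F"
    by (rule subalgebra_sigma_gen_mono) simp
  have ZG: "sets (sigma_gen M Z) \<subseteq> sets ?G" and YK: "sets (sigma_gen M Y) \<subseteq> sets ?K"
    by (intro sets_sigma_gen_mono; simp)+
  show ?thesis
    unfolding cond_indep_given_iff_sets
  proof (intro iffI ballI)
    fix A B assume "cond_indep_alg ?F ?G ?K" "A \<in> sets (sigma_gen M Y)" "B \<in> sets (sigma_gen M Z)"
    then show "AE \<omega> in M. cond_pr ?F (A \<inter> B) \<omega> = cond_pr ?F A \<omega> * cond_pr ?F B \<omega>"
      using YK ZG by (intro cond_pr_Int_eq[OF G FG K]) auto
  next
    assume *: "\<forall>A\<in>sets (sigma_gen M Y). \<forall>B\<in>sets (sigma_gen M Z). AE \<omega> in M.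
      cond_pr ?F (A \<inter> B) \<omega> = cond_pr ?F A \<omega> * cond_pr ?F B \<omega>"
    let ?P = "{C \<inter> B | C B. C \<in> sets ?F \<and> B \<in> sets (sigma_gen M Z)}"
    \<comment> \<open>First \<open>Z\<close> is enlarged to \<open>(X, Z)\<close>, by testing on
      intersections of events of \<open>X\<close> and of \<open>Z\<close>.\<close>
    have "cond_indep_alg ?F (sigma_gen M Y) ?G"
    proof (rule cond_indep_alg_generator[OF F sY])
      show "Int_stable ?P" by (intro Int_stable_Int Int_stable_sets)
      show "?P \<subseteq> events" using F sZ by (auto simp: subalgebra_def)
      show "space M \<in> ?P"
        using sets.top[of ?F] sets.top[of "sigma_gen M Z"] by (auto intro!: exI[of _ "space M"])
      show "sets ?G = sigma_sets (space M) ?P"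
        using sets_algebra_join_Int[of "sigma_gen M Z" ?F "sets (sigma_gen M Z)"]
          sets.sigma_sets_eq[of "sigma_gen M Z"] sets.top[of "sigma_gen M Z"]
        by (simp add: sets_sigma_gen_append)
      fix A D assume A: "A \<in> sets (sigma_gen M Y)" and "D \<in> ?P"
      then obtain B C where D: "D = C \<inter> B" and C: "C \<in> sets ?F" and B: "B \<in> sets (sigma_gen M Z)"
        by blast
      have ev: "A \<in> events" "B \<in> events" "C \<in> events"
        using A B C sY sZ F by (auto simp: subalgebra_def)
      have eq: "AE \<omega> in M. cond_pr ?F A \<omega> * cond_pr ?F D \<omega> = indicator C \<omega> * cond_pr ?F (A \<inter> B) \<omega>"
        using cond_pr_Int[OF F C ev(2)] *[rule_format, OF A B] unfolding D by eventually_elim simp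
      have [measurable]: "C \<in> events" by (rule ev)
      have "expectation (\<lambda>\<omega>. cond_pr ?F A \<omega> * cond_pr ?F D \<omega>)
          = expectation (\<lambda>\<omega>. indicator C \<omega> * cond_pr ?F (A \<inter> B) \<omega>)"
        by (rule integral_cong_AE[OF _ _ eq]) measurable
      also have "\<dots> = prob (C \<inter> (A \<inter> B))"
        using F C ev by (simp add: expectation_mult_cond_pr expectation_indicator_mult)
      also have "C \<inter> (A \<inter> B) = A \<inter> D" unfolding D by blast
      finally show "expectation (\<lambda>\<omega>. cond_pr ?F A \<omega> * cond_pr ?F D \<omega>) = prob (A \<inter> D)" .
    qed
    \<comment> \<open>Now \<open>?F\<close> is contained in \<open>?G\<close>, so the one-sided
      criterion is available and \<open>Y\<close> can be enlarged to \<open>(X, Y)\<close>.\<close>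
    then have "AE \<omega> in M. cond_pr ?G A \<omega> = cond_pr ?F A \<omega>" if "A \<in> sets (sigma_gen M Y)" for A
      using that cond_indep_alg_iff_cond_pr[OF G FG sY] by (simp add: cond_indep_alg_commute)
    then have "cond_indep_alg ?F ?G (algebra_join ?F (sigma_gen M Y))"
      using sets.sigma_sets_eq[of "sigma_gen M Y"] sets.top[of "sigma_gen M Y"]
      by (intro cond_indep_alg_join[OF G FG sY Int_stable_sets]) auto
    then show "cond_indep_alg ?F ?G ?K"
      by (simp add: cond_indep_alg_def sets_sigma_gen_append)
  qed
qed

text \<open>\<open>vec_map []\<close> is constant, so the generated sigma-algebra contains only the
  empty set and the whole space.\<close>

lemma cond_pr_sigma_gen_Nil:
  assumes A: "A \<in> events"
  shows "AE \<omega> in M. cond_pr (sigma_gen M []) A \<omega> = prob A"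
proof (rule cond_pr_charact[OF subalgebra_M_sigma_gen A])
  fix C assume C: "C \<in> sets (sigma_gen M [])"
  have "vec_map [] \<omega> = vec_map [] \<omega>'" for \<omega> \<omega>' :: 'a by (simp add: vec_map_def restrict_def)
  then have "C = {} \<or> C = space M" using C by (auto simp: sets_sigma_gen)
  then show "expectation (\<lambda>\<omega>. prob A * indicator C \<omega>) = prob (A \<inter> C)"
    using A by (auto simp: prob_space)
qed simp_all

text \<open>Given the empty vector, conditional probabilities are plain probabilities, and the
  almost sure product formula becomes an equation between constants.\<close>

lemma indep_vectors_iff_cond_indep_given:
  assumes "rvs Y" "rvs X"
  shows "indep_vectors M Y X \<longleftrightarrow> cond_indep_given M Y X []"
proof -
  have ev: "A \<in> events" if "A \<in> sets (sigma_gen M L)" "rvs L" for A L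
    using subalgebra_M_sigma_gen[of L] that by (auto simp: subalgebra_def)
  have "sigma_sets (space M) {vec_map L -` A \<inter> space M | A. A \<in> sets (borel_Rn (length L))}
      = sets (sigma_gen M L)" for L
    by (simp add: sigma_gen_def sets_vimage_algebra)
  then have "indep_vectors M Y X \<longleftrightarrow> indep_set (sets (sigma_gen M Y)) (sets (sigma_gen M X))"
    using assms by (simp add: indep_vectors_def indep_var_eq measurable_vec_map)
  also have "\<dots> \<longleftrightarrow> (\<forall>A\<in>sets (sigma_gen M Y). \<forall>B\<in>sets (sigma_gen M X). prob (A \<inter> B) = prob A * prob B)"
    using ev assms unfolding indep_sets2_eq by blast
  also have "\<dots> \<longleftrightarrow> cond_indep_given M Y X []"
    unfolding cond_indep_given_iff_sets
  proof (intro ball_cong refl)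
    fix A B assume "A \<in> sets (sigma_gen M Y)" "B \<in> sets (sigma_gen M X)"
    then have "A \<in> events" "B \<in> events" "A \<inter> B \<in> events" using assms ev by blast+
    then have "(AE \<omega> in M. cond_pr (sigma_gen M []) (A \<inter> B) \<omega>
        = cond_pr (sigma_gen M []) A \<omega> * cond_pr (sigma_gen M []) B \<omega>)
      \<longleftrightarrow> (AE \<omega> in M. prob (A \<inter> B) = prob A * prob B)"
      using cond_pr_sigma_gen_Nil[of A] cond_pr_sigma_gen_Nil[of B] cond_pr_sigma_gen_Nil[of "A \<inter> B"]
      by (intro AE_cong_simp eventually_subst) (auto elim: eventually_elim2)
    then show "prob (A \<inter> B) = prob A * prob B \<longleftrightarrow>
      (AE \<omega> in M. cond_pr (sigma_gen M []) (A \<inter> B) \<omega>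
        = cond_pr (sigma_gen M []) A \<omega> * cond_pr (sigma_gen M []) B \<omega>)"
      by simp
  qed
  finally show ?thesis .
qed

section \<open>Variances of conditional probabilities\<close>

lemma variance_cong_AE:
  fixes f g :: "'a \<Rightarrow> real"
  assumes "AE \<omega> in M. f \<omega> = g \<omega>" "f \<in> borel_measurable M" "g \<in> borel_measurable M"
  shows "variance f = variance g"
proof -
  have "expectation f = expectation g" using assms by (intro integral_cong_AE) auto
  then show ?thesis using assms by (intro integral_cong_AE) auto
qed

lemma variance_cond_pr:
  assumes "subalgebra M F" "A \<in> events"
  shows "variance (cond_pr F A) = expectation (\<lambda>\<omega>. cond_pr F A \<omega> * cond_pr F A \<omega>) - (prob A)\<^sup>2"
  using assms integrable_mult_cond_pr[OF integrable_cond_pr[OF assms] assms]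
  by (subst variance_eq) (simp_all add: integrable_cond_pr expectation_cond_pr power2_eq_square)

text \<open>Pythagoras for the projection of \<open>cond_pr G A\<close> to
  \<open>cond_pr F A\<close>: both have mean \<open>prob A\<close>, and the mixed term of the square
  equals the second moment of \<open>cond_pr F A\<close>.\<close>

lemma variance_cond_pr_diff:
  assumes G: "subalgebra M G" and FG: "subalgebra G F" and A: "A \<in> events"
  shows "variance (cond_pr G A) - variance (cond_pr F A)
    = expectation (\<lambda>\<omega>. (cond_pr G A \<omega> - cond_pr F A \<omega>)\<^sup>2)"
proof -
  have F: "subalgebra M F" using G FG by (rule subalgebra_trans)
  note int = integrable_mult_cond_pr[OF integrable_cond_pr]
  have "expectation (\<lambda>\<omega>. cond_pr F A \<omega> * cond_pr G A \<omega>) = expectation (\<lambda>\<omega>. cond_pr F A \<omega> * indicator A \<omega>)"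
    by (intro expectation_mult_cond_pr G A integrable_cond_pr F measurable_from_subalg[OF FG]
        borel_measurable_cond_exp)
  also have "\<dots> = expectation (\<lambda>\<omega>. cond_pr F A \<omega> * cond_pr F A \<omega>)"
    using F A by (simp add: expectation_cond_pr_mult_cond_pr)
  finally have FG': "expectation (\<lambda>\<omega>. cond_pr F A \<omega> * cond_pr G A \<omega>)
    = expectation (\<lambda>\<omega>. cond_pr F A \<omega> * cond_pr F A \<omega>)" .
  have "expectation (\<lambda>\<omega>. (cond_pr G A \<omega> - cond_pr F A \<omega>)\<^sup>2)
    = expectation (\<lambda>\<omega>. cond_pr G A \<omega> * cond_pr G A \<omega> - 2 * (cond_pr F A \<omega> * cond_pr G A \<omega>)
        + cond_pr F A \<omega> * cond_pr F A \<omega>)"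
    by (intro Bochner_Integration.integral_cong) (auto simp: power2_eq_square algebra_simps)
  also have "\<dots> = expectation (\<lambda>\<omega>. cond_pr G A \<omega> * cond_pr G A \<omega>)
      - 2 * expectation (\<lambda>\<omega>. cond_pr F A \<omega> * cond_pr G A \<omega>)
      + expectation (\<lambda>\<omega>. cond_pr F A \<omega> * cond_pr F A \<omega>)"
    using int[OF F A G A] int[OF G A G A] int[OF F A F A] by simp
  finally show ?thesis
    using FG' by (simp add: variance_cond_pr F G A)
qed

lemma variance_cond_pr_mono:
  assumes "subalgebra M G" "subalgebra G F" "A \<in> events"
  shows "variance (cond_pr F A) \<le> variance (cond_pr G A)"
proof -
  have "0 \<le> expectation (\<lambda>\<omega>. (cond_pr G A \<omega> - cond_pr F A \<omega>)\<^sup>2)" by simp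
  then show ?thesis using variance_cond_pr_diff[OF assms] by linarith
qed

lemma variance_cond_pr_eq_iff:
  assumes G: "subalgebra M G" and FG: "subalgebra G F" and A: "A \<in> events"
  shows "variance (cond_pr F A) = variance (cond_pr G A) \<longleftrightarrow>
    (AE \<omega> in M. cond_pr G A \<omega> = cond_pr F A \<omega>)"
proof -
  have F: "subalgebra M F" using G FG by (rule subalgebra_trans)
  \<comment> \<open>The square is split so that each product has a bounded conditional probability
    as a factor.\<close>
  have "integrable M (\<lambda>\<omega>. (cond_pr G A \<omega> - cond_pr F A \<omega>) * cond_pr G A \<omega>
      - (cond_pr G A \<omega> - cond_pr F A \<omega>) * cond_pr F A \<omega>)"
    using A F G by (intro Bochner_Integration.integrable_diff integrable_mult_cond_pr integrable_cond_pr)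
  then have "integrable M (\<lambda>\<omega>. (cond_pr G A \<omega> - cond_pr F A \<omega>)\<^sup>2)"
    by (simp add: power2_eq_square algebra_simps)
  then have "expectation (\<lambda>\<omega>. (cond_pr G A \<omega> - cond_pr F A \<omega>)\<^sup>2) = 0 \<longleftrightarrow>
    (AE \<omega> in M. (cond_pr G A \<omega> - cond_pr F A \<omega>)\<^sup>2 = 0)"
    by (intro integral_nonneg_eq_0_iff_AE) simp_all
  then show ?thesis using variance_cond_pr_diff[OF assms] by auto
qed

end

section \<open>The mean explained variance\<close>

text \<open>Serves to replace a union over uncountably many levels by a countable one. If the
  infimum is attained, a constant sequence works; otherwise every member lies strictly above it, and
  a sequence tending to the infimum gets below each member.\<close>

lemma ex_sequence_coinitial:
  fixes S :: "real set"
  assumes "S \<noteq> {}" "bdd_below S"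
  shows "\<exists>s. (\<forall>n::nat. s n \<in> S) \<and> (\<forall>v\<in>S. \<exists>n. s n \<le> v)"
proof (cases "Inf S \<in> S")
  case True
  then show ?thesis using assms by (intro exI[of _ "\<lambda>_. Inf S"]) (auto intro: cInf_lower)
next
  case False
  have "\<exists>x\<in>S. x < Inf S + inverse (real (Suc n))" for n
    using cInf_lessD[OF assms(1), of "Inf S + inverse (real (Suc n))"] by simp
  then obtain s where s: "\<And>n. s n \<in> S" "\<And>n. s n < Inf S + inverse (real (Suc n))"
    by metis
  have "\<exists>n. s n \<le> v" if "v \<in> S" for v
  proof -
    have "Inf S < v"
      using False that cInf_lower[OF that assms(2)] by (cases "v = Inf S") auto
    then obtain n where "inverse (real (Suc n)) < v - Inf S"
      using reals_Archimedean[of "v - Inf S"] by auto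
    then show ?thesis using s(2)[of n] by (intro exI[of _ n]) linarith
  qed
  then show ?thesis using s(1) by blast
qed

context prob_space
begin

abbreviation ge_event :: "('a \<Rightarrow> real) \<Rightarrow> real \<Rightarrow> 'a set" where
  "ge_event V y \<equiv> {\<omega>\<in>space M. y \<le> V \<omega>}"

text \<open>For the sigma-algebra of a nonempty vector this is the numerator of \<open>xi\<close>;
  for \<open>F = M\<close> it is the denominator. Both are thus values of one functional that is
  monotone in \<open>F\<close>.\<close>

definition explained_variance :: "('a \<Rightarrow> real) \<Rightarrow> 'a measure \<Rightarrow> real" where
  "explained_variance V F = (\<integral>y. variance (cond_pr F (ge_event V y)) \<partial>distr M borel V)"

text \<open>The version of the conditional probability is chosen separately for each
  \<open>y\<close>, so measurability in \<open>y\<close> comes from monotonicity: the second moment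
  and \<open>prob (ge_event V y)\<close> both decrease in \<open>y\<close>. The minus signs turn
  them into increasing functions.\<close>

lemma borel_measurable_variance_cond_pr:
  assumes F: "subalgebra M F" and V: "V \<in> borel_measurable M"
  shows "(\<lambda>y. variance (cond_pr F (ge_event V y))) \<in> borel_measurable borel"
proof -
  interpret F: sigma_finite_subalgebra M F by (rule sigma_finite_subalgebraI[OF F])
  have ev [measurable]: "ge_event V y \<in> events" for y using V by measurable
  note int = integrable_mult_cond_pr[OF integrable_cond_pr[OF F ev] F ev]
  have sub: "ge_event V z \<subseteq> ge_event V y" if "y \<le> z" for y z using that by auto
  have "mono (\<lambda>y. - expectation (\<lambda>\<omega>. cond_pr F (ge_event V y) \<omega> * cond_pr F (ge_event V y) \<omega>))"
  proof (rule monoI)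
    fix y z :: real assume "y \<le> z"
    then have "AE \<omega> in M. cond_pr F (ge_event V z) \<omega> \<le> cond_pr F (ge_event V y) \<omega>"
      using sub[of y z] by (intro F.real_cond_exp_mono) (auto simp: indicator_def)
    then have "AE \<omega> in M. cond_pr F (ge_event V z) \<omega> * cond_pr F (ge_event V z) \<omega>
        \<le> cond_pr F (ge_event V y) \<omega> * cond_pr F (ge_event V y) \<omega>"
      using cond_pr_bounds[OF F ev[of z]] by eventually_elim (auto intro: mult_mono)
    then show "- expectation (\<lambda>\<omega>. cond_pr F (ge_event V y) \<omega> * cond_pr F (ge_event V y) \<omega>)
        \<le> - expectation (\<lambda>\<omega>. cond_pr F (ge_event V z) \<omega> * cond_pr F (ge_event V z) \<omega>)"
      using int by (simp add: integral_mono_AE)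
  qed
  from borel_measurable_mono[OF this]
  have [measurable]: "(\<lambda>y. expectation (\<lambda>\<omega>. cond_pr F (ge_event V y) \<omega> * cond_pr F (ge_event V y) \<omega>))
      \<in> borel_measurable borel" by simp
  have "mono (\<lambda>y. - prob (ge_event V y))"
    using sub by (intro monoI) (simp add: finite_measure_mono)
  from borel_measurable_mono[OF this]
  have [measurable]: "(\<lambda>y. prob (ge_event V y)) \<in> borel_measurable borel" by simp
  show ?thesis unfolding variance_cond_pr[OF F ev] by measurable
qed

lemma integrable_variance_cond_pr:
  assumes F: "subalgebra M F" and V: "V \<in> borel_measurable M"
  shows "integrable (distr M borel V) (\<lambda>y. variance (cond_pr F (ge_event V y)))"
proof -
  interpret D: prob_space "distr M borel V" using V by (rule prob_space_distr)
  have ev [measurable]: "ge_event V y \<in> events" for y using V by measurable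
  have "\<bar>variance (cond_pr F (ge_event V y))\<bar> \<le> 1" for y
  proof -
    let ?P = "cond_pr F (ge_event V y)"
    have "AE \<omega> in M. ?P \<omega> * ?P \<omega> \<le> 1"
      using cond_pr_bounds[OF F ev[of y]] by eventually_elim (simp add: mult_le_one)
    then have "expectation (\<lambda>\<omega>. ?P \<omega> * ?P \<omega>) \<le> expectation (\<lambda>\<omega>. 1)"
      using F ev by (intro integral_mono_AE integrable_mult_cond_pr integrable_cond_pr) simp_all
    then have "expectation (\<lambda>\<omega>. ?P \<omega> * ?P \<omega>) \<le> 1" by (simp add: prob_space)
    then have "variance ?P \<le> 1"
      using variance_cond_pr[OF F ev[of y]] zero_le_power2[of "prob (ge_event V y)"] by linarith
    moreover have "0 \<le> variance ?P" by (rule variance_positive)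
    ultimately show ?thesis by linarith
  qed
  then show ?thesis
    using borel_measurable_variance_cond_pr[OF F V]
    by (intro D.integrable_const_bound[where B=1]) simp_all
qed

lemma explained_variance_mono:
  assumes "subalgebra M G" "subalgebra G F" "V \<in> borel_measurable M"
  shows "explained_variance V F \<le> explained_variance V G"
  unfolding explained_variance_def
  using assms subalgebra_trans[OF assms(1,2)]
  by (intro integral_mono integrable_variance_cond_pr variance_cond_pr_mono) auto

text \<open>
  The hypothesis says that \<open>P\<^sup>V\<close>-almost every level is good. For an arbitrary level \<open>y\<close>, the event
  \<open>V \<ge> y\<close> agrees up to a null set with the union of the events \<open>V \<ge> s\<close> over a countable set of good
  levels \<open>s \<ge> y\<close> approaching their infimum, so it lies in the sigma-algebra generated by the good events.
\<close>

lemma cond_pr_ge_event_eq: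
  assumes G: "subalgebra M G" and FG: "subalgebra G F" and V: "V \<in> borel_measurable M"
    and ae: "AE x in M. AE \<omega> in M. cond_pr G (ge_event V (V x)) \<omega> = cond_pr F (ge_event V (V x)) \<omega>"
  shows "AE \<omega> in M. cond_pr G (ge_event V y) \<omega> = cond_pr F (ge_event V y) \<omega>"
proof -
  have F: "subalgebra M F" using G FG by (rule subalgebra_trans)
  have ev [measurable]: "ge_event V y \<in> events" for y using V by measurable
  define S where "S = {s. AE \<omega> in M. cond_pr G (ge_event V s) \<omega> = cond_pr F (ge_event V s) \<omega>}"
  let ?P = "insert (space M) (ge_event V ` S)"
  let ?L = "sigma (space M) ?P"
  have Pev: "?P \<subseteq> events" using ev by auto
  have L: "sets ?L = sigma_sets (space M) ?P" by (rule sets_measure_of) auto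
  have subL: "subalgebra M ?L"
    using L sets.sigma_sets_subset[OF Pev] by (simp add: subalgebra_def space_measure_of_conv)
  have "Int_stable ?P"
  proof (rule Int_stableI)
    fix A B assume "A \<in> ?P" "B \<in> ?P"
    moreover have "ge_event V s \<inter> ge_event V t = ge_event V (max s t)" for s t by auto
    moreover have "max s t \<in> S" if "s \<in> S" "t \<in> S" for s t using that by (simp add: max_def)
    moreover have "space M \<inter> ge_event V s = ge_event V s" "ge_event V s \<inter> space M = ge_event V s" for s
      by auto
    ultimately show "A \<inter> B \<in> ?P"
      by (elim insertE imageE) (simp_all only: Int_absorb, blast+)
  qed
  moreover have "AE \<omega> in M. cond_pr G B \<omega> = cond_pr F B \<omega>" if "B \<in> ?P" for B
    using that
  proof
    assume "B = space M"
    then show ?thesis using F G by (intro cond_pr_eq_of_mem) (metis sets.top subalgebra_def)+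
  qed (auto simp: S_def)
  \<comment> \<open>The good events are stable under intersection, as the maximum of two good levels
    is one of them; hence equality passes to the sigma-algebra they generate.\<close>
  ultimately have "cond_indep_alg F G (algebra_join F ?L)"
    using L by (intro cond_indep_alg_join[OF G FG subL _ _ L]) blast+
  moreover have "sets ?L \<subseteq> sets (algebra_join F ?L)"
    using subalgebra_algebra_join2[of ?L F] F subL unfolding subalgebra_def by metis
  ultimately have "cond_indep_alg F G ?L" by (rule cond_indep_alg_antimono)
  then have eq: "AE \<omega> in M. cond_pr G B \<omega> = cond_pr F B \<omega>" if "B \<in> sigma_sets (space M) ?P" for B
    using that cond_indep_alg_iff_cond_pr[OF G FG subL] L by simp
  have "\<exists>B\<in>sigma_sets (space M) ?P. AE \<omega> in M. \<omega> \<in> ge_event V y \<longleftrightarrow> \<omega> \<in> B"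
  proof (cases "S \<inter> {y..} = {}")
    case True
    \<comment> \<open>Almost every value of \<open>V\<close> is a good level, so without good levels
      from \<open>y\<close> upwards \<open>V\<close> almost surely stays below
      \<open>y\<close>.\<close>
    have "AE \<omega> in M. \<omega> \<in> ge_event V y \<longleftrightarrow> \<omega> \<in> {}"
      using ae by eventually_elim (use True in \<open>auto simp: S_def\<close>)
    then show ?thesis using sigma_sets.Empty by blast
  next
    case False
    then obtain s where s: "\<And>n::nat. s n \<in> S \<inter> {y..}" "\<And>v. v \<in> S \<inter> {y..} \<Longrightarrow> \<exists>n. s n \<le> v"
      using ex_sequence_coinitial[of "S \<inter> {y..}"] by auto
    have "(\<Union>n. ge_event V (s n)) \<in> sigma_sets (space M) ?P"
      using s(1) by (intro sigma_sets.Union sigma_sets.Basic) auto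
    moreover have "AE \<omega> in M. \<omega> \<in> ge_event V y \<longleftrightarrow> \<omega> \<in> (\<Union>n. ge_event V (s n))"
      using ae AE_space
    proof eventually_elim
      fix \<omega> assume "AE x in M. cond_pr G (ge_event V (V \<omega>)) x = cond_pr F (ge_event V (V \<omega>)) x"
        and sp: "\<omega> \<in> space M"
      then have "V \<omega> \<in> S" by (simp add: S_def)
      then have "\<exists>n. s n \<le> V \<omega>" if "y \<le> V \<omega>" using s(2)[of "V \<omega>"] that by simp
      moreover have "y \<le> V \<omega>" if "s n \<le> V \<omega>" for n using s(1)[of n] that by simp
      ultimately show "\<omega> \<in> ge_event V y \<longleftrightarrow> \<omega> \<in> (\<Union>n. ge_event V (s n))" using sp by blast
    qed
    ultimately show ?thesis by blast
  qed
  then obtain B where B: "B \<in> sigma_sets (space M) ?P"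
    and eqB: "AE \<omega> in M. \<omega> \<in> ge_event V y \<longleftrightarrow> \<omega> \<in> B" by blast
  have Bev: "B \<in> events" using B sets.sigma_sets_subset[OF Pev] by blast
  show ?thesis
    using eq[OF B] cond_pr_cong_AE[OF G ev Bev eqB] cond_pr_cong_AE[OF F ev Bev eqB]
    by eventually_elim simp
qed

text \<open>The difference of the integrands is nonnegative, so equal integrals force equal
  variances at \<open>P\<^sup>V\<close>-almost every level; \<open>cond_pr_ge_event_eq\<close>
  extends this to every level.\<close>

lemma explained_variance_eq_iff:
  assumes G: "subalgebra M G" and FG: "subalgebra G F" and V: "V \<in> borel_measurable M"
  shows "explained_variance V F = explained_variance V G \<longleftrightarrow>
    (\<forall>y. AE \<omega> in M. cond_pr G (ge_event V y) \<omega> = cond_pr F (ge_event V y) \<omega>)"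
proof
  have F: "subalgebra M F" using G FG by (rule subalgebra_trans)
  have ev: "ge_event V y \<in> events" for y using V by measurable
  note eq_iff = variance_cond_pr_eq_iff[OF G FG ev]
  {
    assume "explained_variance V F = explained_variance V G"
    then have "(\<integral>y. variance (cond_pr G (ge_event V y)) - variance (cond_pr F (ge_event V y)) \<partial>distr M borel V) = 0"
      unfolding explained_variance_def
      using integrable_variance_cond_pr[OF F V] integrable_variance_cond_pr[OF G V] by simp
    then have "AE y in distr M borel V.
        variance (cond_pr G (ge_event V y)) - variance (cond_pr F (ge_event V y)) = 0"
      using integrable_variance_cond_pr[OF F V] integrable_variance_cond_pr[OF G V]
        variance_cond_pr_mono[OF G FG ev]
      by (subst (asm) integral_nonneg_eq_0_iff_AE) auto
    \<comment> \<open>Almost every level for the distribution of \<open>V\<close> becomes the level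
      \<open>V x\<close> for almost every \<open>x\<close>.\<close>
    from AE_distrD[OF V this]
    have "AE x in M. AE \<omega> in M. cond_pr G (ge_event V (V x)) \<omega> = cond_pr F (ge_event V (V x)) \<omega>"
      unfolding eq_iff[symmetric] by eventually_elim simp
    then show "\<forall>y. AE \<omega> in M. cond_pr G (ge_event V y) \<omega> = cond_pr F (ge_event V y) \<omega>"
      using cond_pr_ge_event_eq[OF G FG V] by blast
  }
  assume "\<forall>y. AE \<omega> in M. cond_pr G (ge_event V y) \<omega> = cond_pr F (ge_event V y) \<omega>"
  then show "explained_variance V F = explained_variance V G"
    unfolding explained_variance_def eq_iff[symmetric] by simp
qed

lemma cond_pr_M: "A \<in> events \<Longrightarrow> AE \<omega> in M. cond_pr M A \<omega> = indicator A \<omega>"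
  by (rule cond_pr_indicator) (simp_all add: subalgebra_def)

lemma explained_variance_Nil:
  assumes "V \<in> borel_measurable M"
  shows "explained_variance V (sigma_gen M []) = 0"
proof -
  have ev [measurable]: "ge_event V y \<in> events" for y using assms by measurable
  have "variance (cond_pr (sigma_gen M []) (ge_event V y)) = variance (\<lambda>_. prob (ge_event V y))" for y
    by (rule variance_cong_AE[OF cond_pr_sigma_gen_Nil[OF ev]]) simp_all
  then show ?thesis by (simp add: explained_variance_def prob_space)
qed

lemma explained_variance_M:
  assumes "V \<in> borel_measurable M"
  shows "explained_variance V M = (\<integral>y. variance (indicator (ge_event V y)) \<partial>distr M borel V)"
proof -
  have ev [measurable]: "ge_event V y \<in> events" for y using assms by measurable
  have "variance (cond_pr M (ge_event V y)) = variance (indicator (ge_event V y))" for y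
    by (rule variance_cong_AE[OF cond_pr_M[OF ev]]) simp_all
  then show ?thesis by (simp add: explained_variance_def)
qed

text \<open>The convention for the empty vector needs no exception here, since the explained
  variance of a trivial sigma-algebra is zero.\<close>

lemma xi_eq:
  assumes "V \<in> borel_measurable M"
  shows "xi M V L = explained_variance V (sigma_gen M L) / explained_variance V M"
proof (cases "L = []")
  case True
  then show ?thesis using explained_variance_Nil[OF assms] by (simp add: xi_def)
next
  case False
  then show ?thesis
    unfolding explained_variance_M[OF assms]
    by (simp add: xi_def cond_prob_given_def explained_variance_def)
qed

end

section \<open>Perfect dependence and the properties of T\<close>

text \<open>Recovers a real from the rationals below it. The supremum is countable, and in the
  extended reals the excluded rationals can contribute minus infinity, so measurability of the
  supremum needs no boundedness.\<close>

lemma SUP_rat_le_ereal: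
  "(SUP r::rat. if real_of_rat r \<le> v then ereal (real_of_rat r) else - \<infinity>) = ereal v"
proof (rule antisym)
  show "(SUP r. if real_of_rat r \<le> v then ereal (real_of_rat r) else - \<infinity>) \<le> ereal v"
    by (rule SUP_least) simp
  show "ereal v \<le> (SUP r. if real_of_rat r \<le> v then ereal (real_of_rat r) else - \<infinity>)"
  proof (rule dense_le)
    fix z assume "z < ereal v"
    then obtain w where w: "z < ereal w" "w < v"
      using ereal_dense2[of z "ereal v"] by auto
    then obtain r where r: "w < real_of_rat r" "real_of_rat r < v"
      using of_rat_dense by blast
    have "z < ereal (real_of_rat r)" using w(1) r(1) by (simp add: less_trans[of z "ereal w"])
    then have "z \<le> (if real_of_rat r \<le> v then ereal (real_of_rat r) else - \<infinity>)"
      using r by simp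
    also have "\<dots> \<le> (SUP r. if real_of_rat r \<le> v then ereal (real_of_rat r) else - \<infinity>)"
      by (rule SUP_upper) simp
    finally show "z \<le> (SUP r. if real_of_rat r \<le> v then ereal (real_of_rat r) else - \<infinity>)" .
  qed
qed

lemma AE_eq_cong:
  assumes "AE x in M. f x = g x"
  shows "(AE x in M. f x = h x) \<longleftrightarrow> (AE x in M. g x = h x)"
  by (rule eventually_subst) (use assms in \<open>auto elim: eventually_mono\<close>)

context prob_space
begin

text \<open>Each event \<open>V \<ge> y\<close> agrees almost surely with an event of
  \<open>L\<close>, that is, with a preimage of some Borel set \<open>A y\<close>; then
  \<open>V\<close> is rebuilt from the sets \<open>A r\<close> with rational
  \<open>r\<close>.\<close>

lemma ex_function_of_vec:
  assumes V: "V \<in> borel_measurable M"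
    and ind: "\<And>y. AE \<omega> in M. cond_pr (sigma_gen M L) (ge_event V y) \<omega> = indicator (ge_event V y) \<omega>"
  shows "\<exists>f\<in>borel_measurable (borel_Rn (length L)). AE \<omega> in M. V \<omega> = f (vec_map L \<omega>)"
proof -
  \<comment> \<open>The conditional probability is almost surely 0 or 1, so any threshold strictly
    between them would serve.\<close>
  have "{\<omega>\<in>space M. 1/2 \<le> cond_pr (sigma_gen M L) (ge_event V y) \<omega>} \<in> sets (sigma_gen M L)" for y
  proof -
    have "{\<omega>\<in>space (sigma_gen M L). 1/2 \<le> cond_pr (sigma_gen M L) (ge_event V y) \<omega>} \<in> sets (sigma_gen M L)"
      by measurable
    then show ?thesis by simp
  qed
  then have "\<exists>A\<in>sets (borel_Rn (length L)).
      {\<omega>\<in>space M. 1/2 \<le> cond_pr (sigma_gen M L) (ge_event V y) \<omega>} = vec_map L -` A \<inter> space M" for y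
    unfolding sets_sigma_gen[of M L] by blast
  then obtain A where A [measurable]: "\<And>y. A y \<in> sets (borel_Rn (length L))"
    and A_eq: "\<And>y. {\<omega>\<in>space M. 1/2 \<le> cond_pr (sigma_gen M L) (ge_event V y) \<omega>} = vec_map L -` A y \<inter> space M"
    by metis
  \<comment> \<open>Where the supremum is infinite, \<open>real_of_ereal\<close> returns 0; almost
    surely \<open>vec_map L\<close> avoids such points.\<close>
  define f where "f x = real_of_ereal (SUP r::rat. if x \<in> A (real_of_rat r) then ereal (real_of_rat r) else - \<infinity>)" for x
  have f: "f \<in> borel_measurable (borel_Rn (length L))"
    unfolding f_def by measurable
  have "AE \<omega> in M. \<forall>r::rat. cond_pr (sigma_gen M L) (ge_event V (real_of_rat r)) \<omega>
      = indicator (ge_event V (real_of_rat r)) \<omega>"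
    using ind by (simp add: AE_all_countable)
  then have "AE \<omega> in M. V \<omega> = f (vec_map L \<omega>)"
    using AE_space
  proof eventually_elim
    fix \<omega> assume eq: "\<forall>r::rat. cond_pr (sigma_gen M L) (ge_event V (real_of_rat r)) \<omega>
      = indicator (ge_event V (real_of_rat r)) \<omega>" and sp: "\<omega> \<in> space M"
    have *: "vec_map L \<omega> \<in> A (real_of_rat r) \<longleftrightarrow> real_of_rat r \<le> V \<omega>" for r
    proof -
      have "vec_map L \<omega> \<in> A (real_of_rat r) \<longleftrightarrow>
        \<omega> \<in> {\<omega>\<in>space M. 1/2 \<le> cond_pr (sigma_gen M L) (ge_event V (real_of_rat r)) \<omega>}"
        unfolding A_eq using sp by simp
      also have "\<dots> \<longleftrightarrow> real_of_rat r \<le> V \<omega>"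
        using eq[rule_format, of r] sp by (simp add: indicator_def)
      finally show ?thesis .
    qed
    show "V \<omega> = f (vec_map L \<omega>)"
      unfolding f_def * SUP_rat_le_ereal by simp
  qed
  then show ?thesis using f by blast
qed

text \<open>Compares \<open>sigma_gen M L\<close> with the largest algebra \<open>M\<close>, given
  which a conditional probability is the indicator itself.\<close>

lemma explained_variance_eq_M_iff:
  assumes L: "rvs L" and V: "V \<in> borel_measurable M"
  shows "explained_variance V (sigma_gen M L) = explained_variance V M \<longleftrightarrow>
    (\<forall>y. AE \<omega> in M. cond_pr (sigma_gen M L) (ge_event V y) \<omega> = indicator (ge_event V y) \<omega>)"
proof -
  have ev: "ge_event V y \<in> events" for y using V by measurable
  have "(AE \<omega> in M. cond_pr M (ge_event V y) \<omega> = cond_pr (sigma_gen M L) (ge_event V y) \<omega>) \<longleftrightarrow>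
    (AE \<omega> in M. cond_pr (sigma_gen M L) (ge_event V y) \<omega> = indicator (ge_event V y) \<omega>)" for y
    unfolding AE_eq_cong[OF cond_pr_M[OF ev]] by (simp only: eq_commute)
  moreover have "subalgebra M M" by (simp add: subalgebra_def)
  ultimately show ?thesis
    using explained_variance_eq_iff[OF _ subalgebra_M_sigma_gen[OF L] V] by simp
qed

text \<open>If it vanished, the empty vector would explain all of \<open>V\<close>; then
  \<open>V\<close> would be a function of the constant \<open>vec_map []\<close>, hence almost
  surely constant.\<close>

lemma explained_variance_M_pos:
  assumes V: "V \<in> borel_measurable M" and nd: "nondegenerate M V"
  shows "0 < explained_variance V M"
proof -
  have M: "subalgebra M M" by (simp add: subalgebra_def)
  have "explained_variance V (sigma_gen M []) \<noteq> explained_variance V M"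
  proof
    assume "explained_variance V (sigma_gen M []) = explained_variance V M"
    then have "AE \<omega> in M. cond_pr (sigma_gen M []) (ge_event V y) \<omega> = indicator (ge_event V y) \<omega>" for y
      using explained_variance_eq_M_iff[OF _ V, of "[]"] by simp
    from ex_function_of_vec[OF V this] obtain f where f: "AE \<omega> in M. V \<omega> = f (vec_map [] \<omega>)" by blast
    have "vec_map [] \<omega> = (\<lambda>_. undefined)" for \<omega> :: 'a
      by (simp add: vec_map_def restrict_def)
    then have "AE \<omega> in M. V \<omega> = f (\<lambda>_. undefined)" using f by simp
    then show False using nd unfolding nondegenerate_def by blast
  qed
  then show ?thesis
    using explained_variance_mono[OF M subalgebra_M_sigma_gen[of "[]"] V] explained_variance_Nil[OF V]
    by simp
qed

section \<open>Monotonicity and extreme values of \<open>xi\<close>\<close>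

lemma xi_mono:
  assumes "V \<in> borel_measurable M" "nondegenerate M V" "rvs L'" "set L \<subseteq> set L'"
  shows "xi M V L \<le> xi M V L'"
  using explained_variance_M_pos[OF assms(1,2)]
    explained_variance_mono[OF subalgebra_M_sigma_gen[OF assms(3)] subalgebra_sigma_gen_mono[OF assms(4)] assms(1)]
  by (simp add: xi_eq assms(1) divide_right_mono)

lemma xi_eq_iff:
  assumes "V \<in> borel_measurable M" "nondegenerate M V" "rvs L'" "set L \<subseteq> set L'"
  shows "xi M V L = xi M V L' \<longleftrightarrow> (\<forall>y. AE \<omega> in M.
    cond_pr (sigma_gen M L') (ge_event V y) \<omega> = cond_pr (sigma_gen M L) (ge_event V y) \<omega>)"
  using explained_variance_M_pos[OF assms(1,2)]
    explained_variance_eq_iff[OF subalgebra_M_sigma_gen[OF assms(3)] subalgebra_sigma_gen_mono[OF assms(4)] assms(1)]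
  by (simp add: xi_eq assms(1))

lemma xi_le_1:
  assumes "V \<in> borel_measurable M" "nondegenerate M V" "rvs L"
  shows "xi M V L \<le> 1"
  using explained_variance_M_pos[OF assms(1,2)]
    explained_variance_mono[OF _ subalgebra_M_sigma_gen[OF assms(3)] assms(1)]
  by (simp add: xi_eq assms(1) subalgebra_def)

lemma xi_eq_1_iff:
  assumes "V \<in> borel_measurable M" "nondegenerate M V" "rvs L"
  shows "xi M V L = 1 \<longleftrightarrow> (\<forall>y. AE \<omega> in M.
    cond_pr (sigma_gen M L) (ge_event V y) \<omega> = indicator (ge_event V y) \<omega>)"
proof -
  have "xi M V L = 1 \<longleftrightarrow> explained_variance V (sigma_gen M L) = explained_variance V M"
    using explained_variance_M_pos[OF assms(1,2)] by (auto simp: xi_eq assms(1))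
  then show ?thesis using explained_variance_eq_M_iff[OF assms(3,1)] by simp
qed

section \<open>Perfect dependence and conditional independence, component by component\<close>

lemma perfectly_dependent_iff:
  "perfectly_dependent M Y X \<longleftrightarrow> (\<forall>i<length Y. \<exists>f\<in>borel_measurable (borel_Rn (length X)).
    AE \<omega> in M. (Y ! i) \<omega> = f (vec_map X \<omega>))"
proof
  assume "perfectly_dependent M Y X"
  then obtain f where f: "f \<in> borel_Rn (length X) \<rightarrow>\<^sub>M borel_Rn (length Y)"
    and eq: "AE \<omega> in M. vec_map Y \<omega> = f (vec_map X \<omega>)"
    unfolding perfectly_dependent_def by blast
  show "\<forall>i<length Y. \<exists>f\<in>borel_measurable (borel_Rn (length X)). AE \<omega> in M. (Y ! i) \<omega> = f (vec_map X \<omega>)"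
  proof (intro allI impI bexI)
    fix i assume i: "i < length Y"
    then show "(\<lambda>x. f x i) \<in> borel_measurable (borel_Rn (length X))"
      by (intro measurable_compose[OF f] measurable_component_singleton) simp
    show "AE \<omega> in M. (Y ! i) \<omega> = f (vec_map X \<omega>) i"
      using eq by eventually_elim (simp add: vec_map_nth[OF i, symmetric])
  qed
next
  assume "\<forall>i<length Y. \<exists>f\<in>borel_measurable (borel_Rn (length X)). AE \<omega> in M. (Y ! i) \<omega> = f (vec_map X \<omega>)"
  then obtain f where f: "\<And>i. i < length Y \<Longrightarrow> f i \<in> borel_measurable (borel_Rn (length X))"
    and eq: "\<And>i. i < length Y \<Longrightarrow> AE \<omega> in M. (Y ! i) \<omega> = f i (vec_map X \<omega>)"
    by metis
  have "AE \<omega> in M. \<forall>i\<in>{..<length Y}. (Y ! i) \<omega> = f i (vec_map X \<omega>)"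
    using eq by (intro AE_finite_allI) auto
  then have "AE \<omega> in M. vec_map Y \<omega> = (\<lambda>i\<in>{..<length Y}. f i (vec_map X \<omega>))"
    by eventually_elim (auto simp: vec_map_def fun_eq_iff restrict_def)
  moreover have "(\<lambda>x. \<lambda>i\<in>{..<length Y}. f i x) \<in> borel_Rn (length X) \<rightarrow>\<^sub>M borel_Rn (length Y)"
    using f by (intro measurable_restrict) simp
  ultimately show "perfectly_dependent M Y X"
    unfolding perfectly_dependent_def by (intro bexI)
qed

text \<open>The chain only says that each component is determined by \<open>X\<close> and the
  earlier components. The chain rule with \<open>G = M\<close> turns this into independence of
  \<open>(X, Y)\<close> from all events given \<open>X\<close>, so every event of
  \<open>(X, Y)\<close> is almost surely an event of \<open>X\<close>.\<close>

lemma perfectly_dependent_iff_cond_pr: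
  assumes X: "rvs X" and Y: "rvs Y"
  shows "perfectly_dependent M Y X \<longleftrightarrow> (\<forall>i<length Y. \<forall>y. AE \<omega> in M.
    cond_pr (sigma_gen M (X @ rev (take i Y))) (ge_event (Y ! i) y) \<omega> = indicator (ge_event (Y ! i) y) \<omega>)"
    (is "_ \<longleftrightarrow> ?chain")
proof
  assume pd: "perfectly_dependent M Y X"
  show ?chain
  proof (intro allI impI)
    fix i y assume i: "i < length Y"
    then have "Y ! i \<in> borel_measurable M" using Y by simp
    then have ev: "ge_event (Y ! i) y \<in> events" by measurable
    let ?K = "sigma_gen M (X @ rev (take i Y))"
    obtain f where f: "f \<in> borel_measurable (borel_Rn (length X))"
      and eq: "AE \<omega> in M. (Y ! i) \<omega> = f (vec_map X \<omega>)"
      using pd i unfolding perfectly_dependent_iff by blast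
    let ?A = "{\<omega>\<in>space M. y \<le> f (vec_map X \<omega>)}"
    have K: "subalgebra M ?K"
      using X Y set_take_subset[of i Y] by (intro subalgebra_M_sigma_gen) auto
    have [measurable]: "(\<lambda>\<omega>. f (vec_map X \<omega>)) \<in> borel_measurable (sigma_gen M X)"
      by (rule measurable_compose[OF vec_map_measurable_sigma_gen f])
    have "{\<omega>\<in>space (sigma_gen M X). y \<le> f (vec_map X \<omega>)} \<in> sets (sigma_gen M X)" by measurable
    then have A: "?A \<in> sets ?K"
      using sets_sigma_gen_mono[of X "X @ rev (take i Y)" M] by auto
    have Aev: "?A \<in> events" using A K by (auto simp: subalgebra_def)
    have "AE \<omega> in M. \<omega> \<in> ge_event (Y ! i) y \<longleftrightarrow> \<omega> \<in> ?A" using eq by eventually_elim simp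
    then show "AE \<omega> in M. cond_pr ?K (ge_event (Y ! i) y) \<omega> = indicator (ge_event (Y ! i) y) \<omega>"
      using cond_pr_cong_AE[OF K ev Aev] cond_pr_indicator[OF K A]
      by (auto elim: AE_mp simp: indicator_def)
  qed
next
  assume chain: ?chain
  have M: "subalgebra M M" by (simp add: subalgebra_def)
  have X': "subalgebra M (sigma_gen M X)" using X by (rule subalgebra_M_sigma_gen)
  have Yi: "Y ! i \<in> borel_measurable M" if "i < length Y" for i using Y that by simp
  have ev: "ge_event (Y ! i) y \<in> events" if "i < length Y" for i y using Yi[OF that] by measurable
  have "cond_indep_alg (sigma_gen M X) M (sigma_gen M (X @ rev (take (length Y) Y)))"
    unfolding cond_indep_alg_chain[OF M X' X Y order_refl]
  proof (intro allI impI)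
    fix i y assume i: "i < length Y"
    let ?K = "sigma_gen M (X @ rev (take i Y))"
    have K: "subalgebra M ?K"
      using X Y set_take_subset[of i Y] by (intro subalgebra_M_sigma_gen) auto
    then have J: "subalgebra M (algebra_join M ?K)" by (intro subalgebra_algebra_join M)
    \<comment> \<open>The join with \<open>M\<close> contains every event, so conditioning on it
      gives the indicator, as conditioning on \<open>?K\<close> does by the hypothesis.\<close>
    have "ge_event (Y ! i) y \<in> sets (algebra_join M ?K)"
      using ev[OF i] subalgebra_algebra_join1[of ?K M] by (auto simp: subalgebra_def)
    from cond_pr_indicator[OF J this]
    show "AE \<omega> in M. cond_pr (algebra_join M ?K) (ge_event (Y ! i) y) \<omega> = cond_pr ?K (ge_event (Y ! i) y) \<omega>"
      using chain[rule_format, OF i, of y] by eventually_elim simp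
  qed
  moreover have XY: "subalgebra M (sigma_gen M (X @ rev (take (length Y) Y)))"
    using X Y by (intro subalgebra_M_sigma_gen) auto
  ultimately have *: "AE \<omega> in M. cond_pr M C \<omega> = cond_pr (sigma_gen M X) C \<omega>"
    if "C \<in> sets (sigma_gen M (X @ rev Y))" for C
    using cond_indep_alg_iff_cond_pr[OF M X' XY] that by simp
  show "perfectly_dependent M Y X"
    unfolding perfectly_dependent_iff
  proof (intro allI impI)
    fix i assume i: "i < length Y"
    show "\<exists>f\<in>borel_measurable (borel_Rn (length X)). AE \<omega> in M. (Y ! i) \<omega> = f (vec_map X \<omega>)"
    proof (rule ex_function_of_vec[OF Yi[OF i]])
      fix y
      have [measurable]: "Y ! i \<in> borel_measurable (sigma_gen M (X @ rev Y))"
        using i by (intro component_measurable_sigma_gen) simp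
      have "{\<omega>\<in>space (sigma_gen M (X @ rev Y)). y \<le> (Y ! i) \<omega>} \<in> sets (sigma_gen M (X @ rev Y))"
        by measurable
      then have "ge_event (Y ! i) y \<in> sets (sigma_gen M (X @ rev Y))" by simp
      from *[OF this] cond_pr_M[OF ev[OF i, of y]]
      show "AE \<omega> in M. cond_pr (sigma_gen M X) (ge_event (Y ! i) y) \<omega> = indicator (ge_event (Y ! i) y) \<omega>"
        by eventually_elim simp
    qed
  qed
qed

text \<open>The chain rule with the algebra of \<open>(X, Z)\<close> as \<open>G\<close>. Its joins
  repeat \<open>X\<close>, so they are identified with the algebras of
  \<open>(X @ Z) @ rev (take i Y)\<close>.\<close>

lemma cond_indep_given_iff_chain:
  assumes X: "rvs X" and Y: "rvs Y" and Z: "rvs Z"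
  shows "cond_indep_given M Y Z X \<longleftrightarrow> (\<forall>i<length Y. \<forall>y. AE \<omega> in M.
    cond_pr (sigma_gen M ((X @ Z) @ rev (take i Y))) (ge_event (Y ! i) y) \<omega>
    = cond_pr (sigma_gen M (X @ rev (take i Y))) (ge_event (Y ! i) y) \<omega>)"
proof -
  have G: "subalgebra M (sigma_gen M (X @ Z))" "subalgebra (sigma_gen M (X @ Z)) (sigma_gen M X)"
    using X Z by (auto intro!: subalgebra_M_sigma_gen subalgebra_sigma_gen_mono)
  have "cond_indep_given M Y Z X \<longleftrightarrow>
      cond_indep_alg (sigma_gen M X) (sigma_gen M (X @ Z)) (sigma_gen M (X @ rev (take (length Y) Y)))"
    using sets_sigma_gen_eqI[of "X @ Y" "X @ rev Y" M]
    by (simp add: cond_indep_given_iff_alg[OF X Y Z] cond_indep_alg_def)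
  also have "\<dots> \<longleftrightarrow> (\<forall>i<length Y. \<forall>y. AE \<omega> in M.
      cond_pr (algebra_join (sigma_gen M (X @ Z)) (sigma_gen M (X @ rev (take i Y)))) (ge_event (Y ! i) y) \<omega>
      = cond_pr (sigma_gen M (X @ rev (take i Y))) (ge_event (Y ! i) y) \<omega>)"
    by (rule cond_indep_alg_chain[OF G X Y order_refl])
  also have "\<dots> \<longleftrightarrow> (\<forall>i<length Y. \<forall>y. AE \<omega> in M.
      cond_pr (sigma_gen M ((X @ Z) @ rev (take i Y))) (ge_event (Y ! i) y) \<omega>
      = cond_pr (sigma_gen M (X @ rev (take i Y))) (ge_event (Y ! i) y) \<omega>)"
  proof (intro all_cong1 imp_cong refl)
    fix i y assume i: "i < length Y"
    let ?L = "(X @ Z) @ rev (take i Y)"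
    let ?J = "algebra_join (sigma_gen M (X @ Z)) (sigma_gen M (X @ rev (take i Y)))"
    have "Y ! i \<in> borel_measurable M" using Y i by simp
    then have ev: "ge_event (Y ! i) y \<in> events" by measurable
    have "sets (sigma_gen M ?L) = sets (sigma_gen M ((X @ Z) @ (X @ rev (take i Y))))"
      by (rule sets_sigma_gen_eqI) auto
    then have "sets (sigma_gen M ?L) = sets ?J" by (simp only: sets_sigma_gen_append)
    moreover have "subalgebra M (sigma_gen M ?L)"
      using X Y Z set_take_subset[of i Y] by (intro subalgebra_M_sigma_gen) auto
    ultimately have "AE \<omega> in M. cond_pr (sigma_gen M ?L) (ge_event (Y ! i) y) \<omega> = cond_pr ?J (ge_event (Y ! i) y) \<omega>"
      by (intro cond_pr_cong_sets ev)
    from AE_eq_cong[OF this]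
    show "(AE \<omega> in M. cond_pr ?J (ge_event (Y ! i) y) \<omega>
          = cond_pr (sigma_gen M (X @ rev (take i Y))) (ge_event (Y ! i) y) \<omega>) \<longleftrightarrow>
        (AE \<omega> in M. cond_pr (sigma_gen M ?L) (ge_event (Y ! i) y) \<omega>
          = cond_pr (sigma_gen M (X @ rev (take i Y))) (ge_event (Y ! i) y) \<omega>)" ..
  qed
  finally show ?thesis .
qed

section \<open>Properties of \<open>T\<close> for a fixed vector \<open>Y\<close> with nondegenerate
  components\<close>

context
  fixes Y :: "'a rvec"
  assumes Y: "rvs Y" "Y \<noteq> []" and nd: "\<forall>V\<in>set Y. nondegenerate M V"
begin

lemma component_Y:
  assumes "i < length Y"
  shows "Y ! i \<in> borel_measurable M" "nondegenerate M (Y ! i)"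
  using assms Y nd by simp_all

text \<open>No summand exceeds 1, and the one for \<open>i = 0\<close> is 0 because its vector is
  empty.\<close>

lemma T_denominator_pos: "0 < real (length Y) - (\<Sum>i<length Y. xi M (Y ! i) (rev (take i Y)))"
proof -
  have "(\<Sum>i<length Y. xi M (Y ! i) (rev (take i Y))) < (\<Sum>i<length Y. 1)"
  proof (rule sum_strict_mono_ex1)
    show "\<forall>i\<in>{..<length Y}. xi M (Y ! i) (rev (take i Y)) \<le> 1"
      using Y by (intro ballI xi_le_1 component_Y) (auto dest: in_set_takeD)
    show "\<exists>i\<in>{..<length Y}. xi M (Y ! i) (rev (take i Y)) < 1"
      using Y(2) by (intro bexI[of _ 0]) (auto simp: xi_def)
  qed simp
  then show ?thesis by simp
qed

lemma T_mono:
  assumes "rvs X" "rvs Z"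
  shows "T M Y X \<le> T M Y (X @ Z)"
proof -
  have "(\<Sum>i<length Y. xi M (Y ! i) (X @ rev (take i Y))) \<le> (\<Sum>i<length Y. xi M (Y ! i) ((X @ Z) @ rev (take i Y)))"
    using assms Y by (intro sum_mono xi_mono component_Y) (auto dest: in_set_takeD)
  then show ?thesis
    using T_denominator_pos by (simp add: T_def divide_right_mono)
qed

text \<open>The two sums are ordered term by term, so they agree iff all their terms do;
  \<open>xi_eq_iff\<close> turns this into the chain of conditional probabilities.\<close>

lemma T_eq_iff:
  assumes X: "rvs X" and Z: "rvs Z"
  shows "T M Y X = T M Y (X @ Z) \<longleftrightarrow> cond_indep_given M Y Z X"
proof -
  have mono: "xi M (Y ! i) (X @ rev (take i Y)) \<le> xi M (Y ! i) ((X @ Z) @ rev (take i Y))"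
    if "i < length Y" for i
    using assms Y that by (intro xi_mono component_Y) (auto dest: in_set_takeD)
  have "T M Y X = T M Y (X @ Z) \<longleftrightarrow> (\<Sum>i<length Y. xi M (Y ! i) (X @ rev (take i Y)))
      = (\<Sum>i<length Y. xi M (Y ! i) ((X @ Z) @ rev (take i Y)))"
    using T_denominator_pos by (simp add: T_def)
  also have "\<dots> \<longleftrightarrow> (\<forall>i<length Y. xi M (Y ! i) (X @ rev (take i Y)) = xi M (Y ! i) ((X @ Z) @ rev (take i Y)))"
    using mono by (auto dest: sum_mono_inv)
  also have "\<dots> \<longleftrightarrow> cond_indep_given M Y Z X"
    unfolding cond_indep_given_iff_chain[OF X Y(1) Z] using X Y Z
    by (intro all_cong1 imp_cong refl xi_eq_iff component_Y) (auto dest: in_set_takeD)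
  finally show ?thesis .
qed

lemma T_Nil: "T M Y [] = 0"
  using T_denominator_pos by (simp add: T_def)

lemma T_le_1:
  assumes "rvs X"
  shows "T M Y X \<le> 1"
proof -
  have "(\<Sum>i<length Y. xi M (Y ! i) (X @ rev (take i Y))) \<le> (\<Sum>i<length Y. 1)"
    using assms Y by (intro sum_mono xi_le_1 component_Y) (auto dest: in_set_takeD)
  then show ?thesis using T_denominator_pos by (simp add: T_def)
qed

lemma T_eq_1_iff:
  assumes X: "rvs X"
  shows "T M Y X = 1 \<longleftrightarrow> perfectly_dependent M Y X"
proof -
  have le: "xi M (Y ! i) (X @ rev (take i Y)) \<le> 1" if "i < length Y" for i
    using assms Y that by (intro xi_le_1 component_Y) (auto dest: in_set_takeD)
  have "T M Y X = 1 \<longleftrightarrow> (\<Sum>i<length Y. xi M (Y ! i) (X @ rev (take i Y))) = (\<Sum>i<length Y. 1)"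
    using T_denominator_pos by (auto simp: T_def)
  also have "\<dots> \<longleftrightarrow> (\<forall>i<length Y. xi M (Y ! i) (X @ rev (take i Y)) = 1)"
    using le sum_mono_inv[of "\<lambda>i. xi M (Y ! i) (X @ rev (take i Y))" "{..<length Y}" "\<lambda>_. 1"] by auto
  also have "\<dots> \<longleftrightarrow> perfectly_dependent M Y X"
    unfolding perfectly_dependent_iff_cond_pr[OF X Y(1)] using X Y
    by (intro all_cong1 imp_cong refl xi_eq_1_iff component_Y) (auto dest: in_set_takeD)
  finally show ?thesis .
qed

end

end

theorem theorem2p1:
  fixes M :: "'a measure" and X Y :: "'a rvec"
  assumes "prob_space M"
    and "random_vector M X"
    and "random_vector M Y"
    and "\<forall>V\<in>set Y. nondegenerate M V"
  shows
    "(0 \<le> T M Y X \<and> T M Y X \<le> 1) \<and>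
     (T M Y X = 0 \<longleftrightarrow> indep_vectors M Y X) \<and>
     (T M Y X = 1 \<longleftrightarrow> perfectly_dependent M Y X) \<and>
     (\<forall>Z. random_vector M Z \<longrightarrow> T M Y X \<le> T M Y (X @ Z)) \<and>
     (\<forall>Z. random_vector M Z \<longrightarrow> (T M Y X = T M Y (X @ Z) \<longleftrightarrow> cond_indep_given M Y Z X))"
proof -
  interpret prob_space M by fact
  have X: "rvs X" and Y: "rvs Y" "Y \<noteq> []" and nd: "\<forall>V\<in>set Y. nondegenerate M V"
    using assms by (simp_all add: random_vector_def)
  have Z: "rvs Z" if "random_vector M Z" for Z using that by (simp add: random_vector_def)
  \<comment> \<open>The empty list is no \<open>random_vector\<close>, but it satisfies
    \<open>rvs\<close>: it is taken as the smaller vector, and \<open>X\<close> in the place of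
    \<open>Z\<close>.\<close>
  have "0 \<le> T M Y X"
    using T_mono[OF Y nd, of "[]" X] X T_Nil[OF Y nd] by simp
  moreover have "T M Y X = 0 \<longleftrightarrow> indep_vectors M Y X"
    using T_eq_iff[OF Y nd, of "[]" X] X T_Nil[OF Y nd] indep_vectors_iff_cond_indep_given[OF Y(1) X]
    by auto
  ultimately show ?thesis
    using T_le_1[OF Y nd X] T_eq_1_iff[OF Y nd X] T_mono[OF Y nd X Z] T_eq_iff[OF Y nd X Z] by blast
qed

end
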